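(* Let $\mathfrak g=\mathfrak{sl}_2\oplus\mathfrak{sl}_2$, $\theta$ the automorphism exchanging the two summands, and $\mathcal L^{\mathrm{tw}}$ the associated twisted loop algebra of the second kind. For each $\phi \in (\mathcal{L}^{\mathrm{tw},0})^*$, the following are equivalent: (1) $\dim V(\phi) < \infty$. (2) There exist $n \in \mathbb{Z}_{\geq 0}$ and $\alpha_1,\dots,\alpha_n \in \mathbb{C}^\times$ such that $$\phi(w_a) = \sum_{i=1}^n \alpha_i^a \quad \text{for each } a \in \mathbb{Z}.$$
   Context: Let $e_i,f_i,h_i$ ($i=1,2$) be the Chevalley bases of the two summands of $\mathfrak g=\mathfrak{sl}_2\oplus\mathfrak{sl}_2$ over $\mathbb C$; $\theta$ is given by $e_1\leftrightarrow e_2$, $f_1\leftrightarrow f_2$, $h_1\leftrightarrow h_2$. Let $\mathcal L=\mathbb C[t,t^{-1}]\otimes\mathfrak g$ be the loop algebra with $[P\otimes x,Q\otimes y]=PQ\otimes[x,y]$, extend $\theta$ by $\theta(t^m\otimes x)=t^{-m}\otimes\theta(x)$, and let $\mathcal L^{\mathrm{tw}}=\{\mathfrak x\in\mathcal L\mid\theta(\mathfrak x)=\mathfrak x\}$. For $a\in\mathbb Z$ set $x_a=t^a\otimes e_1+t^{-a}\otimes e_2$, $y_a=t^a\otimes f_1+t^{-a}\otimes f_2$, $w_a=t^a\otimes h_1+t^{-a}\otimes h_2$; these form a basis of $\mathcal L^{\mathrm{tw}}$. Let $\mathcal L^{\mathrm{tw},+},\mathcal L^{\mathrm{tw},0}$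 be the spans of the $x_a$, respectively the $w_a$. For $\phi\in(\mathcal L^{\mathrm{tw},0})^*$ (linear dual), $V(\phi)$ denotes the unique simple quotient of the universal highest weight module of highest weight $\phi$, i.e. the unique simple $\mathcal L^{\mathrm{tw}}$-module generated by a nonzero vector $v_\phi$ with $\mathcal L^{\mathrm{tw},+}v_\phi=0$ and $wv_\phi=\phi(w)v_\phi$ for all $w\in\mathcal L^{\mathrm{tw},0}$. *)

theory Defs
  imports "HOL-Analysis.Analysis" "HOL-Library.Poly_Mapping"
begin

section \<open>The Lie algebra $\mathfrak{g} = \mathfrak{sl}_2 \oplus \mathfrak{sl}_2$\<close>

type_synonym mat2 = "complex^2^2"

definition sl2 :: "mat2 set" where
  "sl2 = {A. trace A = 0}"

definition e_mat :: mat2 where "e_mat = vector [vector [0, 1], vector [0, 0]]"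
definition f_mat :: mat2 where "f_mat = vector [vector [0, 0], vector [1, 0]]"
definition h_mat :: mat2 where "h_mat = vector [vector [1, 0], vector [0, -1]]"

definition commutator :: "mat2 \<Rightarrow> mat2 \<Rightarrow> mat2" where
  "commutator A B = A ** B - B ** A"

definition mat_scale :: "complex \<Rightarrow> mat2 \<Rightarrow> mat2" where
  "mat_scale c A = (\<chi> i j. c * A $ i $ j)"

definition g_bracket :: "mat2 \<times> mat2 \<Rightarrow> mat2 \<times> mat2 \<Rightarrow> mat2 \<times> mat2" where
  "g_bracket X Y = (commutator (fst X) (fst Y), commutator (snd X) (snd Y))"

definition g_scale :: "complex \<Rightarrow> mat2 \<times> mat2 \<Rightarrow> mat2 \<times> mat2" where
  "g_scale c X = (mat_scale c (fst X), mat_scale c (snd X))"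

section \<open>The loop algebra and its twisted subalgebra\<close>

text \<open>
  An element of $\mathbb{C}[t,t^{-1}] \otimes \mathfrak{g}$ is encoded as the finitely supported
  family of its coefficients; \<^term>\<open>Poly_Mapping.single m X\<close> stands for $t^m \otimes X$. The
  bracket and the involution are the (bi)linear extensions of their values on the
  elements $t^m \otimes X$.
\<close>

type_synonym loop = "int \<Rightarrow>\<^sub>0 mat2 \<times> mat2"

definition loop_algebra :: "loop set" where
  "loop_algebra = {p. \<forall>m. Poly_Mapping.lookup p m \<in> sl2 \<times> sl2}"

definition loop_scale :: "complex \<Rightarrow> loop \<Rightarrow> loop" where
  "loop_scale c p = Poly_Mapping.map (g_scale c) p"

definition loop_bracket :: "loop \<Rightarrow> loop \<Rightarrow> loop" where
  "loop_bracket p q =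
     (\<Sum>m\<in>Poly_Mapping.keys p. \<Sum>n\<in>Poly_Mapping.keys q.
        Poly_Mapping.single (m + n)
          (g_bracket (Poly_Mapping.lookup p m) (Poly_Mapping.lookup q n)))"

definition theta :: "loop \<Rightarrow> loop" where
  "theta p = (\<Sum>m\<in>Poly_Mapping.keys p.
     Poly_Mapping.single (- m) (prod.swap (Poly_Mapping.lookup p m)))"

lemma lookup_theta: "Poly_Mapping.lookup (theta p) m = prod.swap (Poly_Mapping.lookup p (- m))"
proof -
  have "Poly_Mapping.lookup (theta p) m =
      (\<Sum>k\<in>Poly_Mapping.keys p. if k = - m then prod.swap (Poly_Mapping.lookup p k) else 0)"
    unfolding theta_def lookup_sum
    by (intro sum.cong) (auto simp: lookup_single when_def)
  also have "\<dots> = prod.swap (Poly_Mapping.lookup p (- m))"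
    by (auto simp: sum.delta in_keys_iff zero_prod_def)
  finally show ?thesis .
qed

lemma lookup_loop_scale:
  "Poly_Mapping.lookup (loop_scale c p) m = g_scale c (Poly_Mapping.lookup p m)"
  unfolding loop_scale_def Poly_Mapping.map.rep_eq
  by (auto simp: when_def g_scale_def mat_scale_def zero_prod_def vec_eq_iff)

lemma theta_add: "theta (p + q) = theta p + theta q"
  by (rule poly_mapping_eqI) (simp add: lookup_theta lookup_add prod.swap_def)

lemma theta_zero: "theta 0 = 0"
  by (simp add: theta_def)

lemma theta_uminus: "theta (- p) = - theta p"
  using theta_add[of p "- p"] by (simp add: theta_zero eq_neg_iff_add_eq_0 add.commute)

lemma theta_sum: "theta (sum u A) = (\<Sum>a\<in>A. theta (u a))"
  by (induction A rule: infinite_finite_induct) (auto simp: theta_zero theta_add)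

lemma theta_single: "theta (Poly_Mapping.single m X) = Poly_Mapping.single (- m) (prod.swap X)"
  by (rule poly_mapping_eqI)
    (auto simp: lookup_theta lookup_single when_def zero_prod_def)

lemma theta_scale: "theta (loop_scale c p) = loop_scale c (theta p)"
  by (rule poly_mapping_eqI) (simp add: lookup_theta lookup_loop_scale g_scale_def)

lemma keys_theta: "Poly_Mapping.keys (theta p) = uminus ` Poly_Mapping.keys p"
proof -
  have "m \<in> Poly_Mapping.keys (theta p) \<longleftrightarrow> - m \<in> Poly_Mapping.keys p" for m
    by (cases "Poly_Mapping.lookup p (- m)") (auto simp: in_keys_iff lookup_theta zero_prod_def)
  then show ?thesis by force
qed

lemma theta_bracket: "theta (loop_bracket p q) = loop_bracket (theta p) (theta q)"
  unfolding loop_bracket_def theta_sum theta_single keys_theta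
  by (simp add: sum.reindex lookup_theta g_bracket_def)

lemma loop_algebra_zero: "0 \<in> loop_algebra"
  by (simp add: loop_algebra_def sl2_def zero_prod_def trace_def)

lemma loop_algebra_add: "p \<in> loop_algebra \<Longrightarrow> q \<in> loop_algebra \<Longrightarrow> p + q \<in> loop_algebra"
  by (auto simp: loop_algebra_def sl2_def lookup_add mem_Times_iff trace_add)

lemma loop_algebra_scale: "p \<in> loop_algebra \<Longrightarrow> loop_scale c p \<in> loop_algebra"
  by (auto simp: loop_algebra_def sl2_def lookup_loop_scale g_scale_def mat_scale_def
      mem_Times_iff trace_def simp flip: sum_distrib_left)

lemma loop_algebra_uminus: "p \<in> loop_algebra \<Longrightarrow> - p \<in> loop_algebra"
  by (auto simp: loop_algebra_def sl2_def mem_Times_iff trace_def sum_negf)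

lemma loop_algebra_sum: "(\<And>a. a \<in> A \<Longrightarrow> u a \<in> loop_algebra) \<Longrightarrow> sum u A \<in> loop_algebra"
  by (induction A rule: infinite_finite_induct) (auto simp: loop_algebra_zero loop_algebra_add)

lemma loop_algebra_single: "X \<in> sl2 \<times> sl2 \<Longrightarrow> Poly_Mapping.single m X \<in> loop_algebra"
  by (auto simp: loop_algebra_def lookup_single when_def sl2_def zero_prod_def trace_def)

lemma commutator_sl2: "commutator A B \<in> sl2"
  by (simp add: sl2_def commutator_def trace_sub trace_mul_sym[of A B])

lemma loop_algebra_bracket: "loop_bracket p q \<in> loop_algebra"
  unfolding loop_bracket_def
  by (intro loop_algebra_sum loop_algebra_single) (simp add: g_bracket_def commutator_sl2)

typedef ltw = "{p. p \<in> loop_algebra \<and> theta p = p}"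
  by (rule exI[of _ 0]) (simp add: loop_algebra_zero theta_zero)

setup_lifting type_definition_ltw

instantiation ltw :: ab_group_add
begin
lift_definition zero_ltw :: ltw is 0 by (simp add: loop_algebra_zero theta_zero)
lift_definition plus_ltw :: "ltw \<Rightarrow> ltw \<Rightarrow> ltw" is "(+)"
  by (simp add: loop_algebra_add theta_add)
lift_definition uminus_ltw :: "ltw \<Rightarrow> ltw" is uminus
  by (simp add: loop_algebra_uminus theta_uminus)
lift_definition minus_ltw :: "ltw \<Rightarrow> ltw \<Rightarrow> ltw" is "(-)"
  by (metis (no_types, lifting) diff_conv_add_uminus loop_algebra_add loop_algebra_uminus
      theta_add theta_uminus)
instance by standard (transfer, simp)+
end

lift_definition ltw_scale :: "complex \<Rightarrow> ltw \<Rightarrow> ltw" is loop_scale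
  by (simp add: loop_algebra_scale theta_scale)

lift_definition ltw_bracket :: "ltw \<Rightarrow> ltw \<Rightarrow> ltw" is loop_bracket
  by (simp add: loop_algebra_bracket theta_bracket)

interpretation ltw: vector_space ltw_scale
  by unfold_locales
    (transfer, rule poly_mapping_eqI,
     simp add: lookup_loop_scale lookup_add g_scale_def mat_scale_def vec_eq_iff algebra_simps)+

lemma e_sl2: "e_mat \<in> sl2" and f_sl2: "f_mat \<in> sl2" and h_sl2: "h_mat \<in> sl2"
  by (simp_all add: sl2_def trace_def e_mat_def f_mat_def h_mat_def sum_2)

lemma zero_sl2: "0 \<in> sl2"
  by (simp add: sl2_def trace_def)

lift_definition x_elt :: "int \<Rightarrow> ltw" is
  "\<lambda>a. Poly_Mapping.single a (e_mat, 0) + Poly_Mapping.single (- a) (0, e_mat)"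
  by (simp add: loop_algebra_add loop_algebra_single e_sl2 zero_sl2 theta_add theta_single
      add.commute)

lift_definition y_elt :: "int \<Rightarrow> ltw" is
  "\<lambda>a. Poly_Mapping.single a (f_mat, 0) + Poly_Mapping.single (- a) (0, f_mat)"
  by (simp add: loop_algebra_add loop_algebra_single f_sl2 zero_sl2 theta_add theta_single
      add.commute)

lift_definition w_elt :: "int \<Rightarrow> ltw" is
  "\<lambda>a. Poly_Mapping.single a (h_mat, 0) + Poly_Mapping.single (- a) (0, h_mat)"
  by (simp add: loop_algebra_add loop_algebra_single h_sl2 zero_sl2 theta_add theta_single
      add.commute)

definition ltw_plus :: "ltw set" where "ltw_plus = ltw.span (range x_elt)"

definition ltw_zero :: "ltw set" where "ltw_zero = ltw.span (range w_elt)"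

text \<open>
  A functional on \<^const>\<open>ltw_zero\<close> is represented by any function on \<^typ>\<open>ltw\<close> that is linear
  on \<^const>\<open>ltw_zero\<close>; its values elsewhere are irrelevant.
\<close>

definition ltw_zero_dual :: "(ltw \<Rightarrow> complex) set" where
  "ltw_zero_dual = {\<phi>. (\<forall>u\<in>ltw_zero. \<forall>v\<in>ltw_zero. \<phi> (u + v) = \<phi> u + \<phi> v) \<and>
                       (\<forall>c. \<forall>u\<in>ltw_zero. \<phi> (ltw_scale c u) = c * \<phi> u)}"

section \<open>Vector spaces with an action of the twisted loop algebra\<close>

text \<open>
  The record carries only the operations. The Lie module axioms are imposed on the universal highest
  weight module below by the relations that define it, and they pass to its quotients.
\<close>

record 'v rep =
  rep_carrier :: "'v set"
  rep_add :: "'v \<Rightarrow> 'v \<Rightarrow> 'v"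
  rep_zero :: 'v
  rep_scale :: "complex \<Rightarrow> 'v \<Rightarrow> 'v"
  rep_act :: "ltw \<Rightarrow> 'v \<Rightarrow> 'v"

definition rep_subspace :: "'v rep \<Rightarrow> 'v set \<Rightarrow> bool" where
  "rep_subspace M U \<longleftrightarrow> U \<subseteq> rep_carrier M \<and> rep_zero M \<in> U \<and>
     (\<forall>u\<in>U. \<forall>v\<in>U. rep_add M u v \<in> U) \<and> (\<forall>c. \<forall>u\<in>U. rep_scale M c u \<in> U)"

definition rep_submodule :: "'v rep \<Rightarrow> 'v set \<Rightarrow> bool" where
  "rep_submodule M U \<longleftrightarrow> rep_subspace M U \<and> (\<forall>x. \<forall>u\<in>U. rep_act M x u \<in> U)"

definition rep_span :: "'v rep \<Rightarrow> 'v set \<Rightarrow> 'v set" where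
  "rep_span M S = \<Inter>{U. rep_subspace M U \<and> S \<subseteq> U}"

definition rep_generated :: "'v rep \<Rightarrow> 'v set \<Rightarrow> 'v set" where
  "rep_generated M S = \<Inter>{U. rep_submodule M U \<and> S \<subseteq> U}"

definition rep_finite_dim :: "'v rep \<Rightarrow> bool" where
  "rep_finite_dim M \<longleftrightarrow> (\<exists>B. finite B \<and> B \<subseteq> rep_carrier M \<and> rep_span M B = rep_carrier M)"

definition rep_coset :: "'v rep \<Rightarrow> 'v set \<Rightarrow> 'v \<Rightarrow> 'v set" where
  "rep_coset M N u = rep_add M u ` N"

definition rep_quotient :: "'v rep \<Rightarrow> 'v set \<Rightarrow> 'v set rep" where
  "rep_quotient M N = \<lparr>
     rep_carrier = rep_coset M N ` rep_carrier M,
     rep_add = (\<lambda>A B. \<Union>a\<in>A. \<Union>b\<in>B. rep_coset M N (rep_add M a b)),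
     rep_zero = N,
     rep_scale = (\<lambda>c A. \<Union>a\<in>A. rep_coset M N (rep_scale M c a)),
     rep_act = (\<lambda>x A. \<Union>a\<in>A. rep_coset M N (rep_act M x a))\<rparr>"

text \<open>
  For a highest weight module the sum of all proper submodules is proper, hence it is the unique
  maximal submodule, and the quotient by it is the unique simple quotient.
\<close>

definition rep_radical :: "'v rep \<Rightarrow> 'v set" where
  "rep_radical M = rep_span M (\<Union>{U. rep_submodule M U \<and> U \<noteq> rep_carrier M})"

section \<open>The universal highest weight module and its simple quotient\<close>

text \<open>
  The free vector space on words in elements of \<^typ>\<open>ltw\<close>, on which these elements act by
  prepending a letter. The word $[x_1,\dots,x_n]$ stands for $x_1 \cdots x_n v$, so the empty
  word stands for the generating vector $v$.
\<close>

type_synonym words = "ltw list \<Rightarrow>\<^sub>0 complex"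

definition words_scale :: "complex \<Rightarrow> words \<Rightarrow> words" where
  "words_scale c p = Poly_Mapping.map ((*) c) p"

definition words_act :: "ltw \<Rightarrow> words \<Rightarrow> words" where
  "words_act x p = (\<Sum>ws\<in>Poly_Mapping.keys p.
     Poly_Mapping.single (x # ws) (Poly_Mapping.lookup p ws))"

definition words_rep :: "words rep" where
  "words_rep = \<lparr> rep_carrier = UNIV, rep_add = (+), rep_zero = 0,
     rep_scale = words_scale, rep_act = words_act\<rparr>"

definition hw_vector :: words where
  "hw_vector = Poly_Mapping.single [] 1"

text \<open>
  The first three sets make the quotient a Lie module (the action is linear in the Lie algebra
  element, and brackets act as commutators); the last two impose the highest weight conditions.
  Thus \<^term>\<open>words_rep\<close> modulo the submodule they generate is
  $U(\mathcal{L}) / (U(\mathcal{L}) \mathcal{L}^{+}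
    + \sum_{w \in \mathcal{L}^0} U(\mathcal{L}) (w - \phi(w)))$, where $\mathcal{L}$ denotes
  the twisted loop algebra.
\<close>

definition hw_relations :: "(ltw \<Rightarrow> complex) \<Rightarrow> words set" where
  "hw_relations \<phi> =
     {words_act (x + y) u - (words_act x u + words_act y u) | x y u. True} \<union>
     {words_act (ltw_scale c x) u - words_scale c (words_act x u) | c x u. True} \<union>
     {words_act (ltw_bracket x y) u - (words_act x (words_act y u) - words_act y (words_act x u))
        | x y u. True} \<union>
     {words_act x hw_vector | x. x \<in> ltw_plus} \<union>
     {words_act w hw_vector - words_scale (\<phi> w) hw_vector | w. w \<in> ltw_zero}"

definition universal_hw_module :: "(ltw \<Rightarrow> complex) \<Rightarrow> words set rep" where
  "universal_hw_module \<phi> =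
     rep_quotient words_rep (rep_generated words_rep (hw_relations \<phi>))"

definition simple_hw_module :: "(ltw \<Rightarrow> complex) \<Rightarrow> words set set rep" where
  "simple_hw_module \<phi> =
     rep_quotient (universal_hw_module \<phi>) (rep_radical (universal_hw_module \<phi>))"

end

(* Projecting to the first summand identifies the twisted algebra with the loop algebra of sl_2.
   It acts on functions of finite integer multisets, the dual of the span of the monomials
   y_{a_1} ... y_{a_k} v, where x_a evaluates at a multiset enlarged by a. The submodule generated
   by the indicator F0 of the empty multiset is V(phi): suitable x_a take any nonzero function to one
   that does not vanish at the empty multiset, that is, with a nonzero highest weight component, so
   the kernel of u |-> u F0 is the largest proper submodule.

   If phi(w_a) = sum alpha_i^a, the tensor product of the evaluation modules C^2 at the alpha_i maps
   to these functions and its image contains F0, so V(phi) is finite-dimensional.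

   Conversely let d be the largest length of a nonzero product of the y_a on F0. By sl_2-theory
   d = phi(w_0) and T(b) = x_0^d y_{b_1} ... y_{b_d} F0 is a nonzero function on Z^d, valued in the
   highest weight line. Reflecting lowest to highest weights turns the action of w_c into
   sum_i T(b + c e_i) = phi(w_c) T(b). A linear relation between the y_j F0 makes the shifts of the
   d coordinates algebraic on T, so T can be replaced by a joint eigenfunction of the shifts, and
   its eigenvalues are the alpha_i. *)

theory Submission
  imports Defs "HOL-Library.Function_Algebras" "HOL-Library.Multiset"
    "HOL-Computational_Algebra.Fundamental_Theorem_Algebra"
begin

section \<open>Operators on functions of multisets\<close>

definition fscale :: "complex \<Rightarrow> ('a \<Rightarrow> complex) \<Rightarrow> 'a \<Rightarrow> complex" where
  "fscale c F = (\<lambda>A. c * F A)"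

interpretation fs: vector_space "fscale :: complex \<Rightarrow> ('a \<Rightarrow> complex) \<Rightarrow> 'a \<Rightarrow> complex"
  by unfold_locales (auto simp: fscale_def fun_eq_iff algebra_simps)

lemma fscale_apply [simp]: "fscale c F A = c * F A"
  by (simp add: fscale_def)

lemma sum_fun_apply: "(\<Sum>i\<in>I. f i) A = (\<Sum>i\<in>I. f i A)"
  for f :: "'i \<Rightarrow> 'a \<Rightarrow> complex"
  by (induction I rule: infinite_finite_induct) auto

type_synonym mfun = "int multiset \<Rightarrow> complex"

text \<open>These operators are dual to the action on the polynomials in the \<^term>\<open>y_elt a\<close>,
  with the roles of \<^term>\<open>x_elt a\<close> and \<^term>\<open>y_elt a\<close> exchanged by transposition.\<close>

definition X_op :: "int \<Rightarrow> mfun \<Rightarrow> mfun" where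
  "X_op a F = (\<lambda>A. F (add_mset a A))"

definition W_op :: "(int \<Rightarrow> complex) \<Rightarrow> int \<Rightarrow> mfun \<Rightarrow> mfun" where
  "W_op \<psi> b F = (\<lambda>A. \<psi> b * F A - 2 * (\<Sum>a\<in>#A. F (add_mset (a + b) (A - {#a#}))))"

text \<open>Ordered pairs are summed, so each unordered pair of entries occurs twice. This accounts
  for the factor in \<open>[w_(a+b), y_c] = -2 y_(a+b+c)\<close>, met when \<open>x_b\<close> is
  moved to the right through a monomial in the y's.\<close>

definition Y_op :: "(int \<Rightarrow> complex) \<Rightarrow> int \<Rightarrow> mfun \<Rightarrow> mfun" where
  "Y_op \<psi> b F = (\<lambda>A. (\<Sum>a\<in>#A. \<psi> (a + b) * F (A - {#a#})) -
     (\<Sum>a\<in>#A. \<Sum>c\<in>#A - {#a#}. F (add_mset (a + b + c) (A - {#a#} - {#c#}))))"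

definition F0 :: mfun where
  "F0 A = (if A = {#} then 1 else 0)"

text \<open>Deleting \<open>c\<close> commutes with adding \<open>a\<close> because \<open>c\<close>
  occurs in \<open>A\<close>; for other \<open>c\<close> this would fail when
  \<open>c = a\<close>.\<close>

lemma sum_mset_diff_add:
  "(\<Sum>c\<in>#A. f c (add_mset a A - {#c#})) = (\<Sum>c\<in>#A. f c (add_mset a (A - {#c#})))"
  for f :: "'a \<Rightarrow> 'a multiset \<Rightarrow> complex"
  by (intro arg_cong[where f = sum_mset] image_mset_cong) (simp add: add_mset_diff_bothsides)

locale highest_weight =
  fixes \<psi> :: "int \<Rightarrow> complex"
begin

abbreviation "X \<equiv> X_op"
abbreviation "W \<equiv> W_op \<psi>"
abbreviation "Y \<equiv> Y_op \<psi>"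

lemma W_empty [simp]: "W b F {#} = \<psi> b * F {#}"
  by (simp add: W_op_def)

lemma Y_empty [simp]: "Y b F {#} = 0"
  by (simp add: Y_op_def)

lemma X_apply: "X a F A = F (add_mset a A)"
  by (simp add: X_op_def)

lemma W_add_mset: "W b F (add_mset a A) = W b (X a F) A - 2 * F (add_mset (a + b) A)"
  using sum_mset_diff_add[of "\<lambda>c M. F (add_mset (c + b) M)" a A]
  by (simp add: W_op_def X_op_def add_mset_commute algebra_simps)

text \<open>The terms of \<open>Y b F\<close> that involve the new element \<open>a\<close> are
  \<open>\<psi> (a + b) * F A\<close> and the pairs with \<open>a\<close> in either position;
  together they form \<open>W (a + b) F A\<close>.\<close>

lemma Y_add_mset: "Y b F (add_mset a A) = Y b (X a F) A + W (a + b) F A"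
proof -
  have 1: "(\<Sum>c\<in>#A. \<psi> (c + b) * F (add_mset a A - {#c#}))
      = (\<Sum>c\<in>#A. \<psi> (c + b) * F (add_mset a (A - {#c#})))"
    using sum_mset_diff_add[of "\<lambda>c M. \<psi> (c + b) * F M" a A] by simp
  have 2: "(\<Sum>c\<in>#A. \<Sum>e\<in>#add_mset a A - {#c#}. F (add_mset (c + b + e) (add_mset a A - {#c#} - {#e#})))
     = (\<Sum>c\<in>#A. \<Sum>e\<in>#add_mset a (A - {#c#}). F (add_mset (c + b + e) (add_mset a (A - {#c#}) - {#e#})))"
    using sum_mset_diff_add[of "\<lambda>c M. \<Sum>e\<in>#M. F (add_mset (c + b + e) (M - {#e#}))" a A] by simp
  have 3: "(\<Sum>e\<in>#M. F (add_mset (c + b + e) (add_mset a M - {#e#})))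
     = (\<Sum>e\<in>#M. F (add_mset a (add_mset (c + b + e) (M - {#e#}))))" for c M
    using sum_mset_diff_add[of "\<lambda>e N. F (add_mset (c + b + e) N)" a M]
    by (simp add: add_mset_commute)
  have 4: "(\<Sum>e\<in>#add_mset a M. F (add_mset (c + b + e) (add_mset a M - {#e#})))
     = F (add_mset (c + (a + b)) M) + (\<Sum>e\<in>#M. F (add_mset a (add_mset (c + b + e) (M - {#e#}))))" for c M
    using 3[of c M] by (simp add: algebra_simps)
  have "(\<Sum>c\<in>#A. \<Sum>e\<in>#add_mset a (A - {#c#}). F (add_mset (c + b + e) (add_mset a (A - {#c#}) - {#e#})))
     = (\<Sum>c\<in>#A. F (add_mset (c + (a + b)) (A - {#c#})))
       + (\<Sum>c\<in>#A. \<Sum>e\<in>#A - {#c#}. F (add_mset a (add_mset (c + b + e) (A - {#c#} - {#e#}))))"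
    unfolding 4 sum_mset.distrib ..
  then show ?thesis
    unfolding Y_op_def W_op_def X_op_def using 1 2 by (simp add: algebra_simps)
qed

lemma mset_op_eqI:
  assumes "\<And>F. D F {#} = E F {#}"
    and "\<And>F a A. (\<And>G. D G A = E G A) \<Longrightarrow> D F (add_mset a A) = E F (add_mset a A)"
  shows "D F = (E F :: int multiset \<Rightarrow> complex)"
proof
  fix A show "D F A = E F A" by (induction A arbitrary: F) (use assms in auto)
qed

section \<open>Linearity and commutation relations of the operators\<close>

lemma X_add: "X a (F + G) = X a F + X a G"
  and X_scale: "X a (fscale c F) = fscale c (X a F)"
  by (auto simp: X_op_def)

lemma W_add: "W a (F + G) = W a F + W a G"
  by (rule ext) (simp add: W_op_def sum_mset.distrib algebra_simps)

lemma W_scale: "W a (fscale c F) = fscale c (W a F)"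
  by (rule ext) (simp add: W_op_def sum_mset_distrib_left algebra_simps)

lemma Y_add: "Y a (F + G) = Y a F + Y a G"
  by (rule ext) (simp add: Y_op_def sum_mset.distrib algebra_simps)

lemma Y_scale: "Y a (fscale c F) = fscale c (Y a F)"
  by (rule ext) (simp add: Y_op_def sum_mset_distrib_left algebra_simps)

lemma X_X: "X a (X b F) = X b (X a F)"
  by (simp add: X_op_def add_mset_commute)

lemma W_X: "W b (X a F) = X a (W b F) + fscale 2 (X (a + b) F)"
  by (rule ext) (simp add: X_apply W_add_mset)

text \<open>Oriented for rewriting: with \<open>X_Y\<close> and \<open>W_Y\<close> it moves
  \<open>X\<close> to the right past \<open>W\<close> and \<open>Y\<close>, and \<open>W\<close>
  past \<open>Y\<close>.\<close>

lemma X_W: "X a (W b F) = W b (X a F) - fscale 2 (X (a + b) F)"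
  by (simp add: W_X)

lemma X_Y: "X a (Y b F) = Y b (X a F) + W (a + b) F"
  by (rule ext) (simp add: X_apply Y_add_mset)

lemma X_diff: "X a (F - G) = X a F - X a G"
  by (auto simp: X_op_def)
lemma W_diff: "W a (F - G) = W a F - W a G"
  by (metis W_add add_diff_cancel_right' diff_add_cancel)
lemma Y_diff: "Y a (F - G) = Y a F - Y a G"
  by (metis Y_add add_diff_cancel_right' diff_add_cancel)

text \<open>Evaluating at \<^term>\<open>add_mset a A\<close> means applying \<^term>\<open>X a\<close> and evaluating at
  \<^term>\<open>A\<close>, so an identity between operators holds once it holds at the empty multiset and its
  commutators with all \<^term>\<open>X a\<close> hold.\<close>

lemma eq_via_X:
  assumes "\<And>F. D F {#} = E F {#}"
    and "\<And>F a. X a (D F) - D (X a F) = X a (E F) - E (X a F)"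
  shows "D F = E F"
proof (rule mset_op_eqI[of D E])
  fix F a A assume IH: "\<And>G. D G A = E G A"
  have "(X a (D F) - D (X a F)) A = (X a (E F) - E (X a F)) A" using assms(2) by simp
  then show "D F (add_mset a A) = E F (add_mset a A)" using IH by (simp add: X_apply)
qed (rule assms)

lemmas op_simps = X_add X_diff X_scale W_add W_diff W_scale Y_add Y_diff Y_scale

lemma W_W: "W a (W b F) = W b (W a F)"
  by (rule eq_via_X[of "\<lambda>F. W a (W b F)" "\<lambda>F. W b (W a F)"])
    (simp_all add: op_simps X_W algebra_simps)

lemma W_Y: "W a (Y b F) = Y b (W a F) - fscale 2 (Y (a + b) F)"
  by (rule eq_via_X[of "\<lambda>F. W a (Y b F)" "\<lambda>F. Y b (W a F) - fscale 2 (Y (a + b) F)"])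
    (simp_all add: op_simps X_W X_Y W_W[of _ a] algebra_simps fs.scale_right_distrib)

lemma Y_Y: "Y a (Y b F) = Y b (Y a F)"
  by (rule eq_via_X[of "\<lambda>F. Y a (Y b F)" "\<lambda>F. Y b (Y a F)"])
    (simp_all add: op_simps X_Y W_Y algebra_simps)

text \<open>With \<open>W_F0\<close> this makes \<open>F0\<close> a highest weight vector of weight
  \<open>\<psi>\<close>.\<close>

lemma X_F0 [simp]: "X a F0 = 0"
  by (rule ext) (simp add: X_op_def F0_def)

lemma W_F0 [simp]: "W a F0 = fscale (\<psi> a) F0"
proof
  fix A show "W a F0 A = fscale (\<psi> a) F0 A"
    by (cases A) (auto simp: W_op_def F0_def)
qed

end

section \<open>The action of the loop algebra\<close>

text \<open>For trace zero the three coefficients are the coordinates of \<open>M\<close> in the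
  basis e, f, h. The formula is linear in all matrices; compatibility with commutators is shown for
  trace zero.\<close>

definition sl2_act :: "(int \<Rightarrow> complex) \<Rightarrow> int \<Rightarrow> mat2 \<Rightarrow> mfun \<Rightarrow> mfun" where
  "sl2_act \<psi> m M F = fscale (M $ 1 $ 2) (X_op m F) + fscale (M $ 2 $ 1) (Y_op \<psi> m F)
     + fscale (M $ 1 $ 1) (W_op \<psi> m F)"

definition loop_act :: "(int \<Rightarrow> complex) \<Rightarrow> loop \<Rightarrow> mfun \<Rightarrow> mfun" where
  "loop_act \<psi> p F = (\<Sum>m\<in>Poly_Mapping.keys p. sl2_act \<psi> m (fst (Poly_Mapping.lookup p m)) F)"

context highest_weight
begin

lemma X_zero [simp]: "X a 0 = 0" and W_zero [simp]: "W a 0 = 0" and Y_zero [simp]: "Y a 0 = 0"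
  using X_scale[of a 0 0] W_scale[of a 0 0] Y_scale[of a 0 0] by auto

lemma Y_sum: "Y a (sum f I) = (\<Sum>i\<in>I. Y a (f i))"
  by (induction I rule: infinite_finite_induct) (simp_all only: sum.infinite sum.empty sum.insert Y_add X_zero W_zero Y_zero not_False_eq_True)

lemma sl2_act_vec_zero [simp]: "sl2_act \<psi> m M 0 = 0"
  by (simp add: sl2_act_def)

lemma sl2_act_vec_add: "sl2_act \<psi> m M (F + G) = sl2_act \<psi> m M F + sl2_act \<psi> m M G"
  by (simp add: sl2_act_def op_simps fs.scale_right_distrib)

lemma sl2_act_vec_scale: "sl2_act \<psi> m M (fscale c F) = fscale c (sl2_act \<psi> m M F)"
  by (simp add: sl2_act_def op_simps fs.scale_right_distrib mult.commute)

lemma sl2_act_vec_sum: "sl2_act \<psi> m M (sum f I) = (\<Sum>i\<in>I. sl2_act \<psi> m M (f i))"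
  by (induction I rule: infinite_finite_induct) (simp_all only: sum.infinite sum.empty sum.insert sl2_act_vec_add sl2_act_vec_zero not_False_eq_True)

lemma sl2_act_zero [simp]: "sl2_act \<psi> m 0 F = 0"
  by (simp add: sl2_act_def)

lemma sl2_act_add: "sl2_act \<psi> m (M + N) F = sl2_act \<psi> m M F + sl2_act \<psi> m N F"
  by (simp add: sl2_act_def fs.scale_left_distrib)

lemma sl2_act_scale: "sl2_act \<psi> m (mat_scale c M) F = fscale c (sl2_act \<psi> m M F)"
  by (simp add: sl2_act_def mat_scale_def fs.scale_right_distrib)

lemma sl2_act_commutator:
  assumes "M \<in> sl2" "N \<in> sl2"
  shows "sl2_act \<psi> (m + n) (commutator M N) F
    = sl2_act \<psi> m M (sl2_act \<psi> n N F) - sl2_act \<psi> n N (sl2_act \<psi> m M F)"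
proof -
  have tr: "M $ 2 $ 2 = - M $ 1 $ 1" "N $ 2 $ 2 = - N $ 1 $ 1"
    using assms by (auto simp: sl2_def trace_def sum_2 eq_neg_iff_add_eq_0 add.commute)
  show ?thesis
    \<comment> \<open>Both sides are brought to the order \<open>Y\<close>, \<open>W\<close>,
      \<open>X\<close>; fixing the first index to \<open>n\<close> directs the rules for commuting
      operators.\<close>
    by (rule ext, simp add: sl2_act_def op_simps commutator_def matrix_matrix_mult_def sum_2 tr
        X_W X_Y W_Y X_X[of n] W_W[of n] Y_Y[of n] add.commute[of n m])
      (simp add: algebra_simps)
qed

abbreviation "L \<equiv> loop_act \<psi>"

lemma loop_act_superset:
  assumes "finite S" "Poly_Mapping.keys p \<subseteq> S"
  shows "L p F = (\<Sum>m\<in>S. sl2_act \<psi> m (fst (Poly_Mapping.lookup p m)) F)"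
  unfolding loop_act_def using assms
  by (intro sum.mono_neutral_left) (auto simp: in_keys_iff)

lemma loop_act_add: "L (p + q) F = L p F + L q F"
proof -
  let ?S = "Poly_Mapping.keys p \<union> Poly_Mapping.keys q"
  show ?thesis
    using loop_act_superset[of ?S p F] loop_act_superset[of ?S q F]
      loop_act_superset[of ?S "p + q" F] keys_add[of p q]
    by (simp add: lookup_add sl2_act_add sum.distrib)
qed

lemma loop_act_zero [simp]: "L 0 F = 0"
  by (simp add: loop_act_def)

lemma loop_act_sum: "L (sum f I) F = (\<Sum>i\<in>I. L (f i) F)"
  by (induction I rule: infinite_finite_induct) (simp_all add: loop_act_add)

lemma loop_act_scale: "L (loop_scale c p) F = fscale c (L p F)"
proof -
  have "Poly_Mapping.keys (loop_scale c p) \<subseteq> Poly_Mapping.keys p"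
    by (auto simp: in_keys_iff lookup_loop_scale g_scale_def mat_scale_def zero_prod_def vec_eq_iff)
  then show ?thesis
    by (simp add: loop_act_superset[of "Poly_Mapping.keys p"] lookup_loop_scale g_scale_def
        sl2_act_scale fs.scale_sum_right)
qed

lemma loop_act_single: "L (Poly_Mapping.single m M) F = sl2_act \<psi> m (fst M) F"
  by (simp add: loop_act_superset[of "{m}"])

lemma loop_act_vec_add: "L p (F + G) = L p F + L p G"
  by (simp add: loop_act_def sl2_act_vec_add sum.distrib)

lemma loop_act_vec_scale: "L p (fscale c F) = fscale c (L p F)"
  by (simp add: loop_act_def sl2_act_vec_scale fs.scale_sum_right)

lemma loop_act_bracket:
  assumes "p \<in> loop_algebra" "q \<in> loop_algebra"
  shows "L (loop_bracket p q) F = L p (L q F) - L q (L p F)"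
proof -
  let ?p = "\<lambda>m. fst (Poly_Mapping.lookup p m)" and ?q = "\<lambda>m. fst (Poly_Mapping.lookup q m)"
  have tr: "?p m \<in> sl2" "?q m \<in> sl2" for m
    using assms by (auto simp: loop_algebra_def mem_Times_iff)
  have "L (loop_bracket p q) F = (\<Sum>m\<in>Poly_Mapping.keys p. \<Sum>n\<in>Poly_Mapping.keys q.
      sl2_act \<psi> m (?p m) (sl2_act \<psi> n (?q n) F) - sl2_act \<psi> n (?q n) (sl2_act \<psi> m (?p m) F))"
    by (simp add: loop_bracket_def loop_act_sum loop_act_single g_bracket_def sl2_act_commutator tr)
  also have "\<dots> = L p (L q F) - (\<Sum>m\<in>Poly_Mapping.keys p. \<Sum>n\<in>Poly_Mapping.keys q.
      sl2_act \<psi> n (?q n) (sl2_act \<psi> m (?p m) F))"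
    by (simp add: sum_subtractf loop_act_def sl2_act_vec_sum)
  also have "\<dots> = L p (L q F) - L q (L p F)"
    by (subst sum.swap) (simp add: loop_act_def sl2_act_vec_sum)
  finally show ?thesis .
qed

abbreviation "Lt p \<equiv> L (Rep_ltw p)"

lemma Lt_add: "Lt (p + q) F = Lt p F + Lt q F"
  by (simp add: plus_ltw.rep_eq loop_act_add)

lemma Lt_scale: "Lt (ltw_scale c p) F = fscale c (Lt p F)"
  by (simp add: ltw_scale.rep_eq loop_act_scale)

lemma Lt_bracket: "Lt (ltw_bracket p q) F = Lt p (Lt q F) - Lt q (Lt p F)"
  using Rep_ltw[of p] Rep_ltw[of q] by (simp add: ltw_bracket.rep_eq loop_act_bracket)

lemma Lt_x: "Lt (x_elt a) F = X a F"
  and Lt_y: "Lt (y_elt a) F = Y a F"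
  and Lt_w: "Lt (w_elt a) F = W a F"
  by (simp_all add: x_elt.rep_eq y_elt.rep_eq w_elt.rep_eq loop_act_add loop_act_single
      sl2_act_def e_mat_def f_mat_def h_mat_def)

end

text \<open>Invariance under \<^term>\<open>theta\<close> recovers the second component from the first.\<close>

lemma ltw_eqI:
  assumes "\<And>m. fst (Poly_Mapping.lookup (Rep_ltw p) m) = fst (Poly_Mapping.lookup (Rep_ltw q) m)"
  shows "p = q"
proof -
  have th: "theta (Rep_ltw r) = Rep_ltw r" for r using Rep_ltw by auto
  have sn: "snd (Poly_Mapping.lookup (Rep_ltw r) m) = fst (Poly_Mapping.lookup (Rep_ltw r) (- m))" for r m
    using lookup_theta[of "Rep_ltw r" m] unfolding th by simp
  have "Rep_ltw p = Rep_ltw q"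
    by (rule poly_mapping_eqI) (simp add: prod_eq_iff assms sn)
  then show ?thesis by (simp add: Rep_ltw_inject)
qed

lemma lookup_x_elt: "fst (Poly_Mapping.lookup (Rep_ltw (x_elt a)) m) = (if m = a then e_mat else 0)"
  and lookup_y_elt: "fst (Poly_Mapping.lookup (Rep_ltw (y_elt a)) m) = (if m = a then f_mat else 0)"
  and lookup_w_elt: "fst (Poly_Mapping.lookup (Rep_ltw (w_elt a)) m) = (if m = a then h_mat else 0)"
  by (auto simp: x_elt.rep_eq y_elt.rep_eq w_elt.rep_eq lookup_add lookup_single when_def zero_prod_def)

lemma lookup_ltw_add: "fst (Poly_Mapping.lookup (Rep_ltw (p + q)) m)
    = fst (Poly_Mapping.lookup (Rep_ltw p) m) + fst (Poly_Mapping.lookup (Rep_ltw q) m)"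
  by (simp add: plus_ltw.rep_eq lookup_add)

lemma lookup_ltw_scale: "fst (Poly_Mapping.lookup (Rep_ltw (ltw_scale c p)) m)
    = mat_scale c (fst (Poly_Mapping.lookup (Rep_ltw p) m))"
  by (simp add: ltw_scale.rep_eq lookup_loop_scale g_scale_def)

lemma lookup_ltw_sum: "fst (Poly_Mapping.lookup (Rep_ltw (\<Sum>i\<in>I. f i)) m)
    = (\<Sum>i\<in>I. fst (Poly_Mapping.lookup (Rep_ltw (f i)) m))"
  by (induction I rule: infinite_finite_induct) (simp_all add: lookup_ltw_add zero_ltw.rep_eq)

lemma mat_scale_zero [simp]: "mat_scale c 0 = 0"
  by (simp add: mat_scale_def vec_eq_iff)

text \<open>Each coefficient of the first component is expanded in e, f, h, and by
  \<open>ltw_eqI\<close> first components determine the element.\<close>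

lemma ltw_span_generators: "ltw.span (range x_elt \<union> range y_elt \<union> range w_elt) = UNIV"
proof -
  have "p \<in> ltw.span (range x_elt \<union> range y_elt \<union> range w_elt)" for p
  proof -
    let ?M = "\<lambda>m. fst (Poly_Mapping.lookup (Rep_ltw p) m)" and ?K = "Poly_Mapping.keys (Rep_ltw p)"
    define q where "q = (\<Sum>m\<in>?K. ltw_scale (?M m $ 1 $ 2) (x_elt m)
      + ltw_scale (?M m $ 2 $ 1) (y_elt m) + ltw_scale (?M m $ 1 $ 1) (w_elt m))"
    have "?M m \<in> sl2" for m
      using Rep_ltw[of p] by (auto simp: loop_algebra_def mem_Times_iff)
    then have tr: "?M m $ 2 $ 2 = - ?M m $ 1 $ 1" for m
      by (simp add: sl2_def trace_def sum_2 eq_neg_iff_add_eq_0 add.commute)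
    have decomp: "mat_scale (?M m $ 1 $ 2) e_mat + mat_scale (?M m $ 2 $ 1) f_mat
        + mat_scale (?M m $ 1 $ 1) h_mat = ?M m" for m
      by (simp add: vec_eq_iff forall_2 mat_scale_def e_mat_def f_mat_def h_mat_def tr)
    have "p = q"
    proof (rule ltw_eqI)
      fix m
      have "fst (Poly_Mapping.lookup (Rep_ltw q) m) = (\<Sum>k\<in>?K. if m = k then ?M k else 0)"
        unfolding q_def lookup_ltw_sum
        by (intro sum.cong refl) (auto simp: lookup_ltw_add lookup_ltw_scale lookup_x_elt
            lookup_y_elt lookup_w_elt decomp)
      also have "\<dots> = ?M m" by (auto simp: sum.delta' in_keys_iff)
      finally show "?M m = fst (Poly_Mapping.lookup (Rep_ltw q) m)" ..
    qed
    also have "q \<in> ltw.span (range x_elt \<union> range y_elt \<union> range w_elt)"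
      unfolding q_def by (intro ltw.span_sum ltw.span_add ltw.span_scale ltw.span_base) auto
    finally show ?thesis .
  qed
  then show ?thesis by auto
qed

section \<open>Quotients of the module of words\<close>

lemma lookup_words_scale: "Poly_Mapping.lookup (words_scale c p) k = c * Poly_Mapping.lookup p k"
  by (simp add: words_scale_def Poly_Mapping.map.rep_eq when_def)

interpretation words: vector_space words_scale
  by unfold_locales (rule poly_mapping_eqI, simp add: lookup_words_scale lookup_add algebra_simps)+

lemma words_act_add: "words_act x (p + q) = words_act x p + words_act x q"
  unfolding words_act_def by (rule setsum_keys_plus_distrib) (simp_all add: single_add)

lemma words_act_single: "words_act x (Poly_Mapping.single ws c) = Poly_Mapping.single (x # ws) c"
  by (simp add: words_act_def)

lemma words_act_scale: "words_act x (words_scale c p) = words_scale c (words_act x p)"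
proof -
  have "Poly_Mapping.keys (words_scale c p) \<subseteq> Poly_Mapping.keys p"
    by (auto simp: in_keys_iff lookup_words_scale)
  then have "words_act x (words_scale c p) = (\<Sum>ws\<in>Poly_Mapping.keys p.
      Poly_Mapping.single (x # ws) (Poly_Mapping.lookup (words_scale c p) ws))"
    unfolding words_act_def by (intro sum.mono_neutral_left) (auto simp: in_keys_iff)
  also have "\<dots> = words_scale c (words_act x p)"
    unfolding words_act_def words.scale_sum_right
    by (intro sum.cong refl poly_mapping_eqI)
      (auto simp: lookup_words_scale lookup_single when_def)
  finally show ?thesis .
qed

lemma words_act_zero [simp]: "words_act x 0 = 0"
  by (simp add: words_act_def)

lemma words_act_diff: "words_act x (p - q) = words_act x p - words_act x q"
  by (metis words_act_add add_diff_cancel_right' diff_add_cancel)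

lemma words_submodule_iff:
  "rep_submodule words_rep U \<longleftrightarrow> words.subspace U \<and> (\<forall>x. \<forall>u\<in>U. words_act x u \<in> U)"
  by (auto simp: rep_submodule_def rep_subspace_def words_rep_def words.subspace_def)

lemma words_generated_submodule: "rep_submodule words_rep (rep_generated words_rep S)"
  unfolding rep_generated_def by (auto simp: words_submodule_iff intro!: words.subspace_Inter)

lemma words_generated_superset: "S \<subseteq> rep_generated words_rep S"
  by (auto simp: rep_generated_def)

lemma words_generated_minimal:
  "rep_submodule words_rep K \<Longrightarrow> S \<subseteq> K \<Longrightarrow> rep_generated words_rep S \<subseteq> K"
  by (auto simp: rep_generated_def)

lemma words_single: "Poly_Mapping.single ws c = words_scale c (foldr words_act ws hw_vector)"
proof (induction ws)
  case Nil
  then show ?case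
    by (intro poly_mapping_eqI) (simp add: hw_vector_def lookup_words_scale lookup_single when_def)
next
  case (Cons x ws)
  then show ?case by (simp flip: words_act_scale words_act_single)
qed

lemma words_sum_single:
  "p = (\<Sum>ws\<in>Poly_Mapping.keys p. Poly_Mapping.single ws (Poly_Mapping.lookup p ws))"
  by (rule poly_mapping_eqI)
    (auto simp: lookup_sum lookup_single when_def sum.delta' sum.delta in_keys_iff)

lemma words_submodule_hw_vector:
  assumes "rep_submodule words_rep S" "hw_vector \<in> S"
  shows "S = UNIV"
proof -
  have S: "words.subspace S" "\<And>x u. u \<in> S \<Longrightarrow> words_act x u \<in> S"
    using assms(1) by (auto simp: words_submodule_iff)
  have "foldr words_act ws hw_vector \<in> S" for ws
    by (induction ws) (use assms S in auto)
  then have "Poly_Mapping.single ws c \<in> S" for ws c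
    unfolding words_single by (rule words.subspace_scale[OF S(1)])
  then have "p \<in> S" for p
    by (subst words_sum_single) (rule words.subspace_sum[OF S(1)])
  then show ?thesis by auto
qed

text \<open>\<^term>\<open>presents M q K\<close> says that \<^term>\<open>q\<close> induces an isomorphism from
  \<^term>\<open>words_rep\<close> modulo \<^term>\<open>K\<close> to \<^term>\<open>M\<close>.\<close>

definition presents :: "'v rep \<Rightarrow> (words \<Rightarrow> 'v) \<Rightarrow> words set \<Rightarrow> bool" where
  "presents M q K \<longleftrightarrow> rep_submodule words_rep K \<and> range q = rep_carrier M \<and>
     (\<forall>u v. q u = q v \<longleftrightarrow> u - v \<in> K) \<and> rep_zero M = q 0 \<and>
     (\<forall>u v. rep_add M (q u) (q v) = q (u + v)) \<and>
     (\<forall>c u. rep_scale M c (q u) = q (words_scale c u)) \<and>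
     (\<forall>x u. rep_act M x (q u) = q (words_act x u))"

lemma presents_words: "presents words_rep (\<lambda>u. u) {0}"
proof -
  have "rep_submodule words_rep {0}"
    by (auto simp: words_submodule_iff words.subspace_def)
  then show ?thesis by (simp add: presents_def) (simp add: words_rep_def)
qed

text \<open>The quotient operations are unions over representatives; all members of such a union are
  the same coset, so it collapses. The lemma is applied first to the words and then to the universal
  module.\<close>

lemma presents_quotient:
  assumes M: "presents M q K" and K': "rep_submodule words_rep K'" "K \<subseteq> K'"
  shows "presents (rep_quotient M (q ` K')) (\<lambda>u. rep_coset M (q ` K') (q u)) K'"
proof -
  define C where "C = (\<lambda>u. rep_coset M (q ` K') (q u))"
  have q: "range q = rep_carrier M" "\<And>u v. q u = q v \<longleftrightarrow> u - v \<in> K" "rep_zero M = q 0"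
    "\<And>u v. rep_add M (q u) (q v) = q (u + v)" "\<And>c u. rep_scale M c (q u) = q (words_scale c u)"
    "\<And>x u. rep_act M x (q u) = q (words_act x u)"
    using M by (auto simp: presents_def)
  have s: "words.subspace K'" "\<And>x u. u \<in> K' \<Longrightarrow> words_act x u \<in> K'"
    using K' by (auto simp: words_submodule_iff)
  have C: "C u = q ` {v. v - u \<in> K'}" for u
  proof -
    have "C u = q ` ((+) u ` K')" unfolding C_def rep_coset_def image_image q(4) ..
    also have "(+) u ` K' = {v. v - u \<in> K'}"
    proof (intro set_eqI iffI)
      fix v assume "v \<in> {v. v - u \<in> K'}"
      then show "v \<in> (+) u ` K'" by (intro image_eqI[of _ _ "v - u"]) auto
    qed auto
    finally show ?thesis .
  qed
  have C_eq: "C u = C v \<longleftrightarrow> u - v \<in> K'" for u v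
  proof
    assume "C u = C v"
    moreover have "q u \<in> C u" using words.subspace_0[OF s(1)] by (auto simp: C)
    ultimately obtain w where "u - w \<in> K" "w - v \<in> K'" by (auto simp: C q)
    then show "u - v \<in> K'"
      using words.subspace_add[OF s(1), of "u - w" "w - v"] K'(2) by auto
  next
    assume uv: "u - v \<in> K'"
    have "w - u \<in> K' \<longleftrightarrow> w - v \<in> K'" for w
      using words.subspace_add[OF s(1), of "w - u" "u - v"] words.subspace_diff[OF s(1), of "w - v" "u - v"]
        uv by auto
    then show "C u = C v" by (simp add: C)
  qed
  have mem: "a \<in> C u \<longleftrightarrow> (\<exists>v. a = q v \<and> C v = C u)" for a u
    unfolding C_eq by (auto simp: C)
  have Q: "rep_coset M (q ` K') (q u) = C u" for u by (simp add: C_def)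
  have "C 0 = q ` K'" by (simp add: C)
  moreover have "(\<Union>a\<in>C u. \<Union>b\<in>C v. rep_coset M (q ` K') (rep_add M a b)) = C (u + v)" for u v
  proof -
    have *: "C (u' + v') = C (u + v)" if "C u' = C u" "C v' = C v" for u' v'
      using that words.subspace_add[OF s(1), of "u' - u" "v' - v"] by (simp add: C_eq algebra_simps)
    have "rep_coset M (q ` K') (rep_add M a b) = C (u + v)" if ab: "a \<in> C u" "b \<in> C v" for a b
      proof -
      obtain u' v' where "a = q u'" "C u' = C u" "b = q v'" "C v' = C v"
        using ab unfolding mem by blast
      with *[of u' v'] show ?thesis by (simp only: q(4) Q)
    qed
    moreover have "q u \<in> C u" "q v \<in> C v" unfolding mem by blast+
    ultimately show ?thesis by blast
  qed
  moreover have "(\<Union>a\<in>C u. rep_coset M (q ` K') (rep_scale M c a)) = C (words_scale c u)" for c u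
  proof -
    have *: "C (words_scale c u') = C (words_scale c u)" if "C u' = C u" for u'
      using that words.subspace_scale[OF s(1), of "u' - u" c]
      by (simp add: C_eq words.scale_right_diff_distrib)
    have "rep_coset M (q ` K') (rep_scale M c a) = C (words_scale c u)" if ab: "a \<in> C u" for a
      proof -
      obtain u' where "a = q u'" "C u' = C u"
        using ab unfolding mem by blast
      with *[of u'] show ?thesis by (simp only: q(5) Q)
    qed
    moreover have "q u \<in> C u" unfolding mem by blast
    ultimately show ?thesis by blast
  qed
  moreover have "(\<Union>a\<in>C u. rep_coset M (q ` K') (rep_act M x a)) = C (words_act x u)" for x u
  proof -
    have *: "C (words_act x u') = C (words_act x u)" if "C u' = C u" for u'
      using that s(2)[of "u' - u" x] by (simp add: C_eq words_act_diff)
    have "rep_coset M (q ` K') (rep_act M x a) = C (words_act x u)" if ab: "a \<in> C u" for a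
      proof -
      obtain u' where "a = q u'" "C u' = C u"
        using ab unfolding mem by blast
      with *[of u'] show ?thesis by (simp only: q(6) Q)
    qed
    moreover have "q u \<in> C u" unfolding mem by blast
    ultimately show ?thesis by blast
  qed
  moreover have "range C = rep_coset M (q ` K') ` rep_carrier M"
    by (auto simp: C_def simp flip: q(1))
  ultimately show ?thesis
    using K'(1) C_eq unfolding presents_def rep_quotient_def by (simp add: Q)
qed

text \<open>With \<open>presents_image_submodule\<close>, this is the correspondence between
  submodules of \<open>M\<close> and submodules of the words that contain \<open>K\<close>.\<close>

lemma presents_vimage_submodule:
  assumes M: "presents M q K" and U: "rep_submodule M U"
  shows "rep_submodule words_rep (q -` U)" "K \<subseteq> q -` U" "q ` (q -` U) = U"
proof -
  have q: "range q = rep_carrier M" "\<And>u v. q u = q v \<longleftrightarrow> u - v \<in> K" "rep_zero M = q 0"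
    "\<And>u v. rep_add M (q u) (q v) = q (u + v)" "\<And>c u. rep_scale M c (q u) = q (words_scale c u)"
    "\<And>x u. rep_act M x (q u) = q (words_act x u)"
    using M by (auto simp: presents_def)
  have U': "U \<subseteq> range q" "q 0 \<in> U" "\<And>u v. q u \<in> U \<Longrightarrow> q v \<in> U \<Longrightarrow> q (u + v) \<in> U"
    "\<And>c u. q u \<in> U \<Longrightarrow> q (words_scale c u) \<in> U" "\<And>x u. q u \<in> U \<Longrightarrow> q (words_act x u) \<in> U"
    using U unfolding rep_submodule_def rep_subspace_def by (auto simp: q simp flip: q(4-))
  show "rep_submodule words_rep (q -` U)"
    using U' by (auto simp: words_submodule_iff words.subspace_def)
  show "K \<subseteq> q -` U"
  proof
    fix k assume "k \<in> K"
    then have "q k = q 0" by (simp add: q)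
    then show "k \<in> q -` U" using U' by simp
  qed
  show "q ` (q -` U) = U" using U'(1) by auto
qed

lemma presents_image_submodule:
  assumes M: "presents M q K" and S: "rep_submodule words_rep S"
  shows "rep_submodule M (q ` S)"
proof -
  have q: "range q = rep_carrier M" "rep_zero M = q 0"
    "\<And>u v. rep_add M (q u) (q v) = q (u + v)" "\<And>c u. rep_scale M c (q u) = q (words_scale c u)"
    "\<And>x u. rep_act M x (q u) = q (words_act x u)"
    using M by (auto simp: presents_def)
  show ?thesis
    using S unfolding rep_submodule_def[of M] rep_subspace_def[of M] words_submodule_iff
    by (auto simp: q words.subspace_0 words.subspace_add words.subspace_scale simp flip: q(1))
qed

lemma rep_span_submodule: "rep_submodule M U \<Longrightarrow> rep_span M U = U"
  by (auto simp: rep_span_def rep_submodule_def)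

text \<open>A largest proper submodule above \<open>R\<close> has a largest proper submodule of
  \<open>M\<close> as its image. The union of all proper submodules is then this image, already a
  subspace, so taking the span adds nothing.\<close>

lemma presents_radical:
  assumes M: "presents M q R" and K: "rep_submodule words_rep K" "R \<subseteq> K" "K \<noteq> UNIV"
    and max: "\<And>S. rep_submodule words_rep S \<Longrightarrow> R \<subseteq> S \<Longrightarrow> S \<noteq> UNIV \<Longrightarrow> S \<subseteq> K"
  shows "rep_radical M = q ` K"
proof -
  have q: "range q = rep_carrier M" "\<And>u v. q u = q v \<longleftrightarrow> u - v \<in> R"
    using M by (auto simp: presents_def)
  have "U \<subseteq> q ` K" if U: "rep_submodule M U" "U \<noteq> rep_carrier M" for U
  proof -
    have "q -` U \<noteq> UNIV"
      using presents_vimage_submodule(3)[OF M U(1)] U(2) q(1) by metis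
    then have "q -` U \<subseteq> K"
      using presents_vimage_submodule[OF M U(1)] max by blast
    then show ?thesis using presents_vimage_submodule(3)[OF M U(1)] by blast
  qed
  moreover have "q ` K \<noteq> rep_carrier M"
  proof
    assume "q ` K = rep_carrier M"
    have "u \<in> K" for u
    proof -
      have "q u \<in> q ` K" using \<open>q ` K = rep_carrier M\<close> q(1) by auto
      then obtain k where "k \<in> K" "u - k \<in> R" by (auto simp: q)
      then show ?thesis
        using words.subspace_add[of K "u - k" k] K by (auto simp: words_submodule_iff)
    qed
    then show False using K(3) by auto
  qed
  ultimately have "\<Union>{U. rep_submodule M U \<and> U \<noteq> rep_carrier M} = q ` K"
    using presents_image_submodule[OF M K(1)] by blast
  then show ?thesis
    using rep_span_submodule[OF presents_image_submodule[OF M K(1)]] by (simp add: rep_radical_def)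
qed

text \<open>Both \<open>M\<close> and the range of \<open>f\<close> are the words modulo
  \<open>K\<close>. This moves the question from the record \<open>M\<close> to a subspace of a
  space of functions.\<close>

lemma presents_finite_dim:
  fixes f :: "words \<Rightarrow> 'a \<Rightarrow> complex"
  assumes M: "presents M q K" and lin: "Vector_Spaces.linear words_scale fscale f"
    and ker: "\<And>u. f u = 0 \<longleftrightarrow> u \<in> K"
  shows "rep_finite_dim M \<longleftrightarrow> (\<exists>B. finite B \<and> range f \<subseteq> fs.span B)"
proof -
  interpret f: Vector_Spaces.linear words_scale fscale f by fact
  have q: "range q = rep_carrier M" "\<And>u v. q u = q v \<longleftrightarrow> u - v \<in> K" "rep_zero M = q 0"
    "\<And>u v. rep_add M (q u) (q v) = q (u + v)" "\<And>c u. rep_scale M c (q u) = q (words_scale c u)"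
    using M by (auto simp: presents_def)
  have qf: "q u = q v \<longleftrightarrow> f u = f v" for u v
    using ker[of "u - v"] by (simp add: q f.diff)
  show ?thesis
  proof
    assume "rep_finite_dim M"
    then obtain B where B: "finite B" "B \<subseteq> rep_carrier M" "rep_span M B = rep_carrier M"
      by (auto simp: rep_finite_dim_def)
    obtain B' where B': "finite B'" "B = q ` B'"
      using B q(1) finite_subset_image[of B q UNIV] by auto
    \<comment> \<open>A subspace that contains \<open>B\<close>, hence all of
      \<open>M\<close>.\<close>
    define U where "U = q ` {u. f u \<in> fs.span (f ` B')}"
    have "rep_subspace M U"
      unfolding rep_subspace_def U_def
      by (auto simp: q f.zero f.add f.scale fs.span_zero intro!: fs.span_add fs.span_scale imageI
          simp flip: q(1))
    moreover have "B \<subseteq> U" by (auto simp: B' U_def intro!: imageI fs.span_base)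
    ultimately have "rep_carrier M \<subseteq> U" using B(3) by (auto simp: rep_span_def)
    have "f u \<in> fs.span (f ` B')" for u
    proof -
      have "q u \<in> U" using \<open>rep_carrier M \<subseteq> U\<close> q(1) by auto
      then show ?thesis by (auto simp: U_def qf)
    qed
    then show "\<exists>B. finite B \<and> range f \<subseteq> fs.span B" using B'(1) by blast
  next
    assume "\<exists>B. finite B \<and> range f \<subseteq> fs.span B"
    then obtain B where B: "finite B" "range f \<subseteq> fs.span B" by blast
    \<comment> \<open>\<open>B\<close> may lie outside the range of \<open>f\<close>, so a basis
      inside the range is taken, which can be lifted to words.\<close>
    obtain B0 where B0: "B0 \<subseteq> range f" "fs.independent B0" "range f \<subseteq> fs.span B0"
      using fs.maximal_independent_subset[of "range f"] by blast
    have "finite B0" using fs.independent_span_bound[OF B(1) B0(2)] B0(1) B(2) by blast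
    then obtain Bw where Bw: "finite Bw" "B0 = f ` Bw"
      using B0(1) finite_subset_image[of B0 f UNIV] by auto
    have "rep_subspace M (rep_carrier M)"
      unfolding rep_subspace_def by (auto simp: q simp flip: q(1))
    then have "rep_span M (q ` Bw) \<subseteq> rep_carrier M"
      unfolding rep_span_def by (intro Inter_lower) (auto simp flip: q(1))
    moreover have "q u \<in> U" if U: "rep_subspace M U" "q ` Bw \<subseteq> U" for u U
    proof -
      have "words.subspace (q -` U)"
        using U(1) unfolding rep_subspace_def words.subspace_def
        by (auto simp: q(3) simp flip: q(4,5))
      moreover have "Bw \<subseteq> q -` U" using U(2) by auto
      ultimately have sp: "words.span Bw \<subseteq> q -` U" by (rule words.span_minimal[rotated])
      have "f u \<in> f ` words.span Bw"
        using B0(3) by (auto simp: Bw(2) f.span_image)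
      then obtain w where "w \<in> words.span Bw" "q u = q w" by (auto simp: qf)
      then show ?thesis using sp by auto
    qed
    then have "rep_carrier M \<subseteq> rep_span M (q ` Bw)"
      unfolding rep_span_def by (auto simp flip: q(1))
    ultimately show "rep_finite_dim M"
      unfolding rep_finite_dim_def using Bw(1) q(1) by (intro exI[of _ "q ` Bw"]) auto
  qed
qed

section \<open>The simple highest weight module\<close>

lemma lookup_ltw_bracket:
  assumes "\<And>m. fst (Poly_Mapping.lookup (Rep_ltw p) m) = (if m = a then M else 0)"
    and "\<And>m. fst (Poly_Mapping.lookup (Rep_ltw q) m) = (if m = b then N else 0)"
  shows "fst (Poly_Mapping.lookup (Rep_ltw (ltw_bracket p q)) k)
    = (if k = a + b then commutator M N else 0)"
proof -
  let ?P = "Rep_ltw p" and ?Q = "Rep_ltw q"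
  have z: "commutator 0 B = 0" "commutator A 0 = 0" for A B
    by (simp_all add: commutator_def matrix_matrix_mult_def vec_eq_iff)
  have fs: "fst (\<Sum>i\<in>I. f i) = (\<Sum>i\<in>I. fst (f i))" for f :: "int \<Rightarrow> mat2 \<times> mat2" and I
    by (induction I rule: infinite_finite_induct) auto
  have "fst (Poly_Mapping.lookup (Rep_ltw (ltw_bracket p q)) k)
    = (\<Sum>m\<in>Poly_Mapping.keys ?P. \<Sum>n\<in>Poly_Mapping.keys ?Q.
        if m = a then if n = b then if k = a + b then commutator M N else 0 else 0 else 0)"
    unfolding ltw_bracket.rep_eq loop_bracket_def lookup_sum fs
    by (intro sum.cong refl) (auto simp: lookup_single when_def g_bracket_def assms z)
  also have "\<dots> = (\<Sum>m\<in>Poly_Mapping.keys ?P. if m = a then (\<Sum>n\<in>Poly_Mapping.keys ?Q.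
        if n = b then if k = a + b then commutator M N else 0 else 0) else 0)"
    by (intro sum.cong refl) auto
  also have "\<dots> = (if k = a + b then commutator M N else 0)"
  proof -
    \<comment> \<open>If the degree \<open>a\<close> or \<open>b\<close> is absent from the keys,
      the coefficient there is zero and so is the commutator.\<close>
    have "M = 0" if "a \<notin> Poly_Mapping.keys ?P"
      using that assms(1)[of a] by (simp add: in_keys_iff)
    moreover have "N = 0" if "b \<notin> Poly_Mapping.keys ?Q"
      using that assms(2)[of b] by (simp add: in_keys_iff)
    ultimately show ?thesis by (auto simp: z)
  qed
  finally show ?thesis .
qed

lemma commutator_e_f: "commutator e_mat f_mat = h_mat"
  and commutator_h_f: "commutator h_mat f_mat = mat_scale (- 2) f_mat"
  by (simp_all add: commutator_def matrix_matrix_mult_def vec_eq_iff forall_2 sum_2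
      e_mat_def f_mat_def h_mat_def mat_scale_def)

lemma ltw_bracket_x_y: "ltw_bracket (x_elt a) (y_elt b) = w_elt (a + b)"
  by (rule ltw_eqI)
    (simp add: lookup_ltw_bracket[OF lookup_x_elt lookup_y_elt] lookup_w_elt commutator_e_f)

lemma ltw_bracket_w_y: "ltw_bracket (w_elt a) (y_elt b) = ltw_scale (- 2) (y_elt (a + b))"
  by (rule ltw_eqI)
    (simp add: lookup_ltw_bracket[OF lookup_w_elt lookup_y_elt] lookup_ltw_scale lookup_y_elt
      commutator_h_f del: ltw.scale_minus_left)

definition y_word :: "int list \<Rightarrow> words" where
  "y_word bs = foldr (\<lambda>b. words_act (y_elt b)) bs hw_vector"

lemma y_word_Nil: "y_word [] = hw_vector"
  and y_word_Cons: "y_word (b # bs) = words_act (y_elt b) (y_word bs)"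
  by (simp_all add: y_word_def)

locale hw_module =
  fixes \<phi> :: "ltw \<Rightarrow> complex"
  assumes dual: "\<phi> \<in> ltw_zero_dual"
begin

abbreviation "\<psi> \<equiv> \<lambda>a. \<phi> (w_elt a)"

sublocale highest_weight \<psi> .

section \<open>Congruence modulo the relations of the universal highest weight module\<close>

definition R :: "words set" where
  "R = rep_generated words_rep (hw_relations \<phi>)"

lemma R_submodule: "rep_submodule words_rep R"
  by (simp add: R_def words_generated_submodule)

lemma R_subspace: "words.subspace R"
  and R_act: "u \<in> R \<Longrightarrow> words_act x u \<in> R"
  using R_submodule by (auto simp: words_submodule_iff)

definition eqv :: "words \<Rightarrow> words \<Rightarrow> bool" (infix "\<doteq>" 50) where
  "u \<doteq> v \<longleftrightarrow> u - v \<in> R"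

lemma eqv_refl [simp]: "u \<doteq> u"
  by (simp add: eqv_def words.subspace_0[OF R_subspace])

lemma eqv_sym: "u \<doteq> v \<Longrightarrow> v \<doteq> u"
  using words.subspace_neg[OF R_subspace, of "u - v"] by (simp add: eqv_def)

lemma eqv_trans [trans]: "u \<doteq> v \<Longrightarrow> v \<doteq> w \<Longrightarrow> u \<doteq> w"
  using words.subspace_add[OF R_subspace, of "u - v" "v - w"] by (simp add: eqv_def)

lemma eqv_add: "u \<doteq> v \<Longrightarrow> u' \<doteq> v' \<Longrightarrow> u + u' \<doteq> v + v'"
  using words.subspace_add[OF R_subspace, of "u - v" "u' - v'"] by (simp add: eqv_def algebra_simps)

lemma eqv_diff: "u \<doteq> v \<Longrightarrow> u' \<doteq> v' \<Longrightarrow> u - u' \<doteq> v - v'"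
  using words.subspace_diff[OF R_subspace, of "u - v" "u' - v'"] by (simp add: eqv_def algebra_simps)

lemma eqv_scale: "u \<doteq> v \<Longrightarrow> words_scale c u \<doteq> words_scale c v"
  using words.subspace_scale[OF R_subspace, of "u - v"]
  by (simp add: eqv_def words.scale_right_diff_distrib)

lemma eqv_act: "u \<doteq> v \<Longrightarrow> words_act x u \<doteq> words_act x v"
  using R_act[of "u - v"] by (simp add: eqv_def words_act_diff)

lemma relation_eqv: "u - v \<in> hw_relations \<phi> \<Longrightarrow> u \<doteq> v"
  using words_generated_superset[of "hw_relations \<phi>"] by (auto simp: eqv_def R_def)

lemma eqv_act_add: "words_act (x + y) u \<doteq> words_act x u + words_act y u"
  by (rule relation_eqv) (unfold hw_relations_def, blast)

lemma eqv_act_scale: "words_act (ltw_scale c x) u \<doteq> words_scale c (words_act x u)"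
  by (rule relation_eqv) (unfold hw_relations_def, blast)

lemma eqv_act_bracket:
  "words_act (ltw_bracket x y) u \<doteq> words_act x (words_act y u) - words_act y (words_act x u)"
  by (rule relation_eqv) (unfold hw_relations_def, blast)

lemma eqv_act_x_hw: "words_act (x_elt a) hw_vector \<doteq> 0"
  using ltw.span_base[of "x_elt a" "range x_elt"]
  by (intro relation_eqv) (auto simp: hw_relations_def ltw_plus_def)

lemma w_elt_ltw_zero: "w_elt a \<in> ltw_zero"
  using ltw.span_base[of "w_elt a" "range w_elt"] by (simp add: ltw_zero_def)

lemma eqv_act_w_hw: "words_act (w_elt a) hw_vector \<doteq> words_scale (\<psi> a) hw_vector"
  using w_elt_ltw_zero by (intro relation_eqv) (auto simp: hw_relations_def)

lemma eqv_act_x_y: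
  "words_act (x_elt a) (words_act (y_elt b) u)
    \<doteq> words_act (y_elt b) (words_act (x_elt a) u) + words_act (w_elt (a + b)) u"
  using eqv_act_bracket[of "x_elt a" "y_elt b" u] words.subspace_neg[OF R_subspace]
  by (fastforce simp: ltw_bracket_x_y eqv_def algebra_simps)

lemma eqv_act_w_y:
  "words_act (w_elt a) (words_act (y_elt b) u)
    \<doteq> words_act (y_elt b) (words_act (w_elt a) u) - words_scale 2 (words_act (y_elt (a + b)) u)"
proof -
  have "words_act (w_elt a) (words_act (y_elt b) u) - words_act (y_elt b) (words_act (w_elt a) u)
    \<doteq> words_scale (- 2) (words_act (y_elt (a + b)) u)"
    using eqv_trans[OF eqv_sym[OF eqv_act_bracket[of "w_elt a" "y_elt b" u]]
        eqv_act_scale[of "- 2" "y_elt (a + b)" u, folded ltw_bracket_w_y]] .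
  from eqv_add[OF this eqv_refl[of "words_act (y_elt b) (words_act (w_elt a) u)"]]
  show ?thesis by simp
qed

section \<open>Monomials in the \<open>y_elt a\<close> span the universal module\<close>

definition y_span :: "words set" where
  "y_span = {u. \<exists>s\<in>words.span (range y_word). u \<doteq> s}"

lemma y_span_subspace: "words.subspace y_span"
  unfolding words.subspace_def y_span_def
  by (blast intro: words.span_zero eqv_refl words.span_add eqv_add words.span_scale eqv_scale)

lemma y_span_eqv: "u \<in> y_span \<Longrightarrow> v \<doteq> u \<Longrightarrow> v \<in> y_span"
  by (auto simp: y_span_def intro: eqv_trans)

lemma y_word_y_span: "y_word bs \<in> y_span"
  by (auto simp: y_span_def intro!: bexI[of _ "y_word bs"] words.span_base)

lemma act_y_span:
  assumes "\<And>bs. words_act x (y_word bs) \<in> y_span" and "u \<in> y_span"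
  shows "words_act x u \<in> y_span"
proof -
  obtain s where s: "s \<in> words.span (range y_word)" "u \<doteq> s"
    using assms(2) by (auto simp: y_span_def)
  have "words_act x s \<in> y_span"
    using s(1)
  proof (induction rule: words.span_induct_alt)
    case base
    then show ?case by (simp add: words.subspace_0[OF y_span_subspace])
  next
    case (step c v s)
    then show ?case using assms(1)
      by (auto simp: words_act_add words_act_scale
          intro!: words.subspace_add[OF y_span_subspace] words.subspace_scale[OF y_span_subspace])
  qed
  then show ?thesis using eqv_act[OF s(2)] y_span_eqv by blast
qed

lemma act_y_y_span: "u \<in> y_span \<Longrightarrow> words_act (y_elt b) u \<in> y_span"
  by (rule act_y_span) (simp_all add: y_word_y_span flip: y_word_Cons)

text \<open>Moving \<open>w_elt a\<close> to the right past a letter only adds a multiple of another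
  monomial, and on \<open>hw_vector\<close> it is a scalar.\<close>

lemma act_w_y_word: "words_act (w_elt a) (y_word bs) \<in> y_span"
proof (induction bs)
  case Nil
  show ?case unfolding y_word_Nil
    by (rule y_span_eqv[OF _ eqv_act_w_hw])
      (use y_word_y_span[of "[]"] words.subspace_scale[OF y_span_subspace] in \<open>simp add: y_word_Nil\<close>)
next
  case (Cons b bs)
  show ?case unfolding y_word_Cons
    by (rule y_span_eqv[OF _ eqv_act_w_y])
      (intro words.subspace_diff[OF y_span_subspace] words.subspace_scale[OF y_span_subspace]
        act_y_y_span Cons y_word_y_span)
qed

text \<open>Moving \<open>x_elt a\<close> past a letter leaves some \<open>w_elt\<close> acting on a
  shorter monomial, and \<open>hw_vector\<close> is killed.\<close>

lemma act_x_y_word: "words_act (x_elt a) (y_word bs) \<in> y_span"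
proof (induction bs)
  case Nil
  show ?case unfolding y_word_Nil
    by (rule y_span_eqv[OF _ eqv_act_x_hw]) (rule words.subspace_0[OF y_span_subspace])
next
  case (Cons b bs)
  show ?case unfolding y_word_Cons
    by (rule y_span_eqv[OF _ eqv_act_x_y])
      (intro words.subspace_add[OF y_span_subspace] act_y_y_span Cons act_w_y_word)
qed

lemma act_y_span_closed: "u \<in> y_span \<Longrightarrow> words_act x u \<in> y_span"
proof -
  assume u: "u \<in> y_span"
  have "x \<in> ltw.span (range x_elt \<union> range y_elt \<union> range w_elt)"
    by (simp add: ltw_span_generators)
  then show ?thesis
  proof (induction rule: ltw.span_induct_alt)
    case base
    \<comment> \<open>In the free module on words the letter 0 does not act as zero; it does so only
      modulo the scaling relation.\<close>
    have "words_act (ltw_scale 0 0) u \<doteq> 0" using eqv_act_scale[of 0 0 u] by simp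
    then show ?case using y_span_eqv words.subspace_0[OF y_span_subspace] by simp
  next
    case (step c z x)
    have "words_act z u \<in> y_span"
      using step(1) u act_y_y_span act_y_span[OF act_x_y_word] act_y_span[OF act_w_y_word] by auto
    then have "words_act (ltw_scale c z) u \<in> y_span"
      using y_span_eqv[OF _ eqv_act_scale] words.subspace_scale[OF y_span_subspace] by blast
    then show ?case
      using y_span_eqv[OF _ eqv_act_add] words.subspace_add[OF y_span_subspace] step(2) by blast
  qed
qed

text \<open>The spanning half of a Poincare-Birkhoff-Witt statement; linear independence is not
  claimed.\<close>

lemma y_span_UNIV: "y_span = UNIV"
proof (rule words_submodule_hw_vector)
  show "rep_submodule words_rep y_span"
    by (simp add: words_submodule_iff y_span_subspace act_y_span_closed)
  show "hw_vector \<in> y_span" using y_word_y_span[of "[]"] by (simp add: y_word_Nil)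
qed

section \<open>The map from words to functions of multisets, \<open>u\<close> acting on
  \<open>F0\<close>\<close>

definition eval_word :: "words \<Rightarrow> mfun" where
  "eval_word p = (\<Sum>ws\<in>Poly_Mapping.keys p. fscale (Poly_Mapping.lookup p ws) (foldr Lt ws F0))"

lemma eval_word_add: "eval_word (p + q) = eval_word p + eval_word q"
  unfolding eval_word_def by (rule setsum_keys_plus_distrib) (simp_all only: fs.scale_left_distrib fs.scale_zero_left)

lemma eval_word_superset:
  assumes "finite S" "Poly_Mapping.keys p \<subseteq> S"
  shows "eval_word p = (\<Sum>ws\<in>S. fscale (Poly_Mapping.lookup p ws) (foldr Lt ws F0))"
  unfolding eval_word_def using assms
  by (intro sum.mono_neutral_left) (auto simp: in_keys_iff)

lemma eval_word_scale: "eval_word (words_scale c p) = fscale c (eval_word p)"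
proof -
  have "Poly_Mapping.keys (words_scale c p) \<subseteq> Poly_Mapping.keys p"
    by (auto simp: in_keys_iff lookup_words_scale)
  then show ?thesis
    by (simp add: eval_word_superset[of "Poly_Mapping.keys p"] lookup_words_scale fs.scale_sum_right)
qed

lemma eval_word_linear: "Vector_Spaces.linear words_scale fscale eval_word"
  by unfold_locales (simp_all add: eval_word_add eval_word_scale)

sublocale eval: Vector_Spaces.linear words_scale fscale eval_word
  by (rule eval_word_linear)

lemma eval_word_single: "eval_word (Poly_Mapping.single ws c) = fscale c (foldr Lt ws F0)"
  by (simp add: eval_word_superset[of "{ws}"])

lemma eval_hw_vector: "eval_word hw_vector = F0"
  by (simp add: hw_vector_def eval_word_single)

lemma Lt_sum: "Lt x (sum f I) = (\<Sum>i\<in>I. Lt x (f i))"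
proof -
  have "Lt x 0 = 0" using loop_act_vec_scale[of "Rep_ltw x" 0 0] by simp
  then show ?thesis
    by (induction I rule: infinite_finite_induct)
      (simp_all only: sum.infinite sum.empty sum.insert loop_act_vec_add not_False_eq_True)
qed

lemma eval_word_act: "eval_word (words_act x p) = Lt x (eval_word p)"
  unfolding words_act_def eval.sum eval_word_single
  by (simp add: eval_word_def Lt_sum loop_act_vec_scale)

lemma Lt_plus_F0: "x \<in> ltw_plus \<Longrightarrow> Lt x F0 = 0"
  unfolding ltw_plus_def
proof (induction rule: ltw.span_induct_alt)
  case base
  show ?case by (simp add: zero_ltw.rep_eq)
next
  case (step c z x)
  then show ?case by (auto simp: Lt_add Lt_scale Lt_x)
qed

lemma Lt_zero_F0: "w \<in> ltw_zero \<Longrightarrow> Lt w F0 = fscale (\<phi> w) F0"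
proof -
  have d: "\<phi> (u + v) = \<phi> u + \<phi> v" "\<phi> (ltw_scale c u) = c * \<phi> u"
    if "u \<in> ltw_zero" "v \<in> ltw_zero" for u v c
    using dual that by (auto simp: ltw_zero_dual_def)
  assume "w \<in> ltw_zero"
  then have "w \<in> ltw.span (range w_elt)" by (simp add: ltw_zero_def)
  \<comment> \<open>Membership is carried along because \<open>\<phi>\<close> is only known to be
    linear on \<open>ltw_zero\<close>.\<close>
  then have "w \<in> ltw_zero \<and> Lt w F0 = fscale (\<phi> w) F0"
  proof (induction rule: ltw.span_induct_alt)
    case base
    have "\<phi> 0 = 0" using d(2)[of 0 0 0] by (simp add: ltw_zero_def ltw.span_zero)
    then show ?case by (simp add: zero_ltw.rep_eq ltw_zero_def ltw.span_zero)
  next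
    case (step c z x)
    then have "z \<in> ltw_zero" "Lt z F0 = fscale (\<phi> z) F0" "ltw_scale c z \<in> ltw_zero" "x \<in> ltw_zero"
      by (auto simp: Lt_w w_elt_ltw_zero ltw_zero_def intro: ltw.span_scale ltw.span_base)
    then show ?case using step
      by (auto simp: Lt_add Lt_scale d fs.scale_left_distrib ltw_zero_def intro: ltw.span_add)
  qed
  then show ?thesis ..
qed

section \<open>The kernel is the largest proper submodule\<close>

definition K :: "words set" where
  "K = {u. eval_word u = 0}"

lemma K_submodule: "rep_submodule words_rep K"
  using loop_act_vec_scale[of _ 0 0]
  by (auto simp: K_def words_submodule_iff words.subspace_def eval_word_add eval_word_scale
      eval_word_act eval.zero)

text \<open>The operators satisfy every defining relation, so evaluation at \<open>F0\<close>
  factors through the universal module.\<close>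

lemma R_subset_K: "R \<subseteq> K"
  unfolding R_def
  by (rule words_generated_minimal[OF K_submodule])
    (auto simp: hw_relations_def K_def eval_word_add eval_word_scale eval.diff eval_word_act
      eval_hw_vector Lt_add Lt_scale Lt_bracket Lt_plus_F0 Lt_zero_F0)

lemma eqv_eval: "u \<doteq> v \<Longrightarrow> eval_word u = eval_word v"
  using R_subset_K by (auto simp: eqv_def K_def eval.diff)

lemma K_proper: "K \<noteq> UNIV"
proof -
  have "F0 \<noteq> 0" by (auto simp: F0_def fun_eq_iff)
  then have "hw_vector \<notin> K" by (simp add: K_def eval_hw_vector)
  then show ?thesis by blast
qed

text \<open>Modulo the relations, \<^term>\<open>weight_cut N\<close> is the projection to the highest weight space
  along the weight spaces of depth \<^term>\<open>1\<close> up to \<^term>\<open>N\<close>.\<close>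

fun weight_cut :: "nat \<Rightarrow> words \<Rightarrow> words" where
  "weight_cut 0 u = u"
| "weight_cut (Suc N) u = words_scale (1 / (2 * of_nat (Suc N)))
     (words_act (w_elt 0) (weight_cut N u)
       - words_scale (\<psi> 0 - 2 * of_nat (Suc N)) (weight_cut N u))"

lemma weight_cut_add: "weight_cut N (u + v) = weight_cut N u + weight_cut N v"
  by (induction N) (simp_all add: words_act_add words.scale_right_distrib words.scale_right_diff_distrib)

lemma weight_cut_scale: "weight_cut N (words_scale c u) = words_scale c (weight_cut N u)"
  by (induction N) (simp_all add: words_act_scale words.scale_right_diff_distrib mult.commute)

lemma weight_cut_submodule:
  "rep_submodule words_rep S \<Longrightarrow> u \<in> S \<Longrightarrow> weight_cut N u \<in> S"
  by (induction N)
    (auto simp: words_submodule_iff intro!: words.subspace_scale words.subspace_diff)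

lemma weight_cut_eqv: "u \<doteq> v \<Longrightarrow> weight_cut N u \<doteq> weight_cut N v"
  by (induction N) (auto intro!: eqv_scale eqv_diff eqv_act)

lemma act_w0_y_word:
  "words_act (w_elt 0) (y_word bs) \<doteq> words_scale (\<psi> 0 - 2 * of_nat (length bs)) (y_word bs)"
proof (induction bs)
  case Nil
  show ?case using eqv_act_w_hw[of 0] by (simp add: y_word_Nil)
next
  case (Cons b bs)
  have "words_act (w_elt 0) (y_word (b # bs))
    \<doteq> words_act (y_elt b) (words_act (w_elt 0) (y_word bs)) - words_scale 2 (y_word (b # bs))"
    using eqv_act_w_y[of 0 b "y_word bs"] by (simp add: y_word_Cons)
  also have "\<dots> \<doteq> words_act (y_elt b) (words_scale (\<psi> 0 - 2 * of_nat (length bs)) (y_word bs))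
      - words_scale 2 (y_word (b # bs))"
    by (intro eqv_diff eqv_act Cons eqv_refl)
  also have "\<dots> = words_scale (\<psi> 0 - 2 * of_nat (length (b # bs))) (y_word (b # bs))"
    by (simp add: words_act_scale y_word_Cons algebra_simps flip: words.scale_left_diff_distrib)
  finally show ?case .
qed

text \<open>On a monomial of length l, \<open>w_elt 0\<close> acts by \<open>\<psi> 0 - 2 l\<close>,
  so the k-th step multiplies by \<open>(2 k - 2 l) / (2 k)\<close>.\<close>

lemma weight_cut_y_word:
  "weight_cut N (y_word bs) \<doteq>
    words_scale (\<Prod>k=1..N. 1 - of_nat (length bs) / of_nat k) (y_word bs)"
proof (induction N)
  case 0
  show ?case by simp
next
  case (Suc N)
  let ?c = "\<Prod>k=1..N. 1 - of_nat (length bs) / of_nat k :: complex"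
  have "weight_cut (Suc N) (y_word bs) \<doteq> words_scale (1 / (2 * of_nat (Suc N)))
     (words_scale ?c (words_scale (\<psi> 0 - 2 * of_nat (length bs)) (y_word bs))
       - words_scale (\<psi> 0 - 2 * of_nat (Suc N)) (words_scale ?c (y_word bs)))"
  proof -
    have "words_act (w_elt 0) (weight_cut N (y_word bs)) \<doteq> words_act (w_elt 0) (words_scale ?c (y_word bs))"
      by (rule eqv_act[OF Suc])
    also have "\<dots> \<doteq> words_scale ?c (words_scale (\<psi> 0 - 2 * of_nat (length bs)) (y_word bs))"
      unfolding words_act_scale by (rule eqv_scale[OF act_w0_y_word])
    finally show ?thesis unfolding weight_cut.simps
      by (intro eqv_scale eqv_diff Suc)
  qed
  also have "\<dots> = words_scale (\<Prod>k=1..Suc N. 1 - of_nat (length bs) / of_nat k) (y_word bs)"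
  proof -
    have "1 / (2 * of_nat (Suc N)) * (?c * (\<psi> 0 - 2 * of_nat (length bs)) - (\<psi> 0 - 2 * of_nat (Suc N)) * ?c)
      = ?c * (1 - of_nat (length bs) / of_nat (Suc N))"
      by (simp add: field_simps del: of_nat_Suc)
    then show ?thesis
      by (simp add: mult.commute del: of_nat_Suc flip: words.scale_left_diff_distrib)
  qed
  finally show ?case .
qed

lemma Y_apply_empty_foldr: "bs \<noteq> [] \<Longrightarrow> foldr Y bs F {#} = 0"
  by (cases bs) auto

lemma eval_y_word: "eval_word (y_word bs) = foldr Y bs F0"
  by (induction bs) (simp_all add: y_word_Nil y_word_Cons eval_hw_vector eval_word_act Lt_y)

text \<open>The product in \<open>weight_cut_y_word\<close> has a zero factor once \<open>N\<close>
  reaches a positive length, and it is 1 for the empty monomial. Only finitely many monomials occur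
  in \<open>u\<close>, and evaluation at the empty multiset reads off the coefficient of the empty
  one.\<close>

lemma weight_cut_eventually:
  "\<exists>N0. \<forall>N\<ge>N0. weight_cut N u \<doteq> words_scale (eval_word u {#}) hw_vector"
proof -
  obtain s where s: "s \<in> words.span (range y_word)" "u \<doteq> s"
    using y_span_UNIV by (auto simp: y_span_def set_eq_iff)
  have "\<exists>N0. \<forall>N\<ge>N0. weight_cut N s \<doteq> words_scale (eval_word s {#}) hw_vector"
    using s(1)
  proof (induction rule: words.span_induct_alt)
    case base
    have "weight_cut N 0 = 0" for N using weight_cut_scale[of N 0 0] by simp
    then show ?case by (simp add: eval.zero)
  next
    case (step c v s)
    then obtain bs where v: "v = y_word bs" by auto
    have 1: "weight_cut N v \<doteq> words_scale (eval_word v {#}) hw_vector" if "N \<ge> length bs" for N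
    proof (cases "bs = []")
      case True
      then show ?thesis using weight_cut_y_word[of N bs]
        by (simp add: v y_word_Nil eval_hw_vector F0_def)
    next
      case False
      then have "(\<Prod>k=1..N. 1 - of_nat (length bs) / of_nat k :: complex) = 0"
        using that by (intro prod_zero bexI[of _ "length bs"]) (auto simp: Suc_le_eq)
      from weight_cut_y_word[of N bs, unfolded this] show ?thesis using False
        by (simp add: v eval_y_word Y_apply_empty_foldr)
    qed
    obtain N0 where 2: "\<And>N. N \<ge> N0 \<Longrightarrow> weight_cut N s \<doteq> words_scale (eval_word s {#}) hw_vector"
      using step(2) by blast
    have "weight_cut N (words_scale c v + s) \<doteq> words_scale (eval_word (words_scale c v + s) {#}) hw_vector"
      if "N \<ge> max N0 (length bs)" for N
      using eqv_add[OF eqv_scale[OF 1, of N c] 2[of N]] that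
      by (simp add: weight_cut_add weight_cut_scale eval_word_add eval_word_scale words.scale_left_distrib)
    then show ?case by blast
  qed
  then show ?thesis using weight_cut_eqv[OF s(2)] eqv_eval[OF s(2)] eqv_trans by metis
qed

text \<open>A submodule is stable under \<open>weight_cut\<close>, so it contains the highest weight
  component of \<open>u\<close>, a nonzero multiple of \<open>hw_vector\<close>.\<close>

lemma hw_vector_mem:
  assumes S: "rep_submodule words_rep S" "R \<subseteq> S" and u: "u \<in> S" "eval_word u {#} \<noteq> 0"
  shows "hw_vector \<in> S"
proof -
  have S': "words.subspace S" using S by (simp add: words_submodule_iff)
  obtain N where "weight_cut N u - words_scale (eval_word u {#}) hw_vector \<in> S"
    using weight_cut_eventually[of u] S(2) by (auto simp: eqv_def)
  then have "words_scale (eval_word u {#}) hw_vector \<in> S"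
    using words.subspace_diff[OF S' weight_cut_submodule[OF S(1) u(1), of N]] by fastforce
  from words.subspace_scale[OF S' this, of "1 / eval_word u {#}"] show ?thesis
    using u(2) by simp
qed

lemma proper_submodule_subset_K:
  assumes S: "rep_submodule words_rep S" "R \<subseteq> S" "S \<noteq> UNIV"
  shows "S \<subseteq> K"
proof (rule ccontr)
  assume "\<not> S \<subseteq> K"
  then obtain u where u: "u \<in> S" "eval_word u \<noteq> 0" by (auto simp: K_def)
  then obtain A where A: "eval_word u A \<noteq> 0" by (auto simp: fun_eq_iff)
  \<comment> \<open>Acting by \<open>x_elt a\<close> strips one element \<open>a\<close> from the
    multiset at which the function is nonzero, until it is empty.\<close>
  have "\<exists>v\<in>S. eval_word v {#} \<noteq> 0"
    using u(1) A
  proof (induction A arbitrary: u)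
    case (add a A)
    have "words_act (x_elt a) u \<in> S" using S(1) add(2) by (auto simp: words_submodule_iff)
    moreover have "eval_word (words_act (x_elt a) u) A \<noteq> 0"
      using add(3) by (simp add: eval_word_act Lt_x X_apply)
    ultimately show ?case using add(1) by blast
  qed auto
  then show False using hw_vector_mem[OF S(1,2)] words_submodule_hw_vector[OF S(1)] S(3) by blast
qed

theorem finite_dim_iff:
  "rep_finite_dim (simple_hw_module \<phi>) \<longleftrightarrow> (\<exists>B. finite B \<and> range eval_word \<subseteq> fs.span B)"
proof -
  obtain q where q: "presents (universal_hw_module \<phi>) q R"
    using presents_quotient[OF presents_words R_submodule] words.subspace_0[OF R_subspace]
    by (auto simp: universal_hw_module_def R_def)
  have rad: "rep_radical (universal_hw_module \<phi>) = q ` K"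
    using presents_radical[OF q K_submodule R_subset_K K_proper] proper_submodule_subset_K by blast
  show ?thesis
    using presents_finite_dim[OF presents_quotient[OF q K_submodule R_subset_K] eval_word_linear]
    by (auto simp: simple_hw_module_def rad K_def)
qed

lemma range_eval_word: "range eval_word = fs.span (range (\<lambda>bs. foldr Y bs F0))"
proof -
  have "range eval_word = eval_word ` words.span (range y_word)"
  proof (intro equalityI image_subsetI)
    fix u
    obtain s where "s \<in> words.span (range y_word)" "u \<doteq> s"
      using y_span_UNIV by (auto simp: y_span_def set_eq_iff)
    then show "eval_word u \<in> eval_word ` words.span (range y_word)" using eqv_eval by blast
  qed auto
  also have "\<dots> = fs.span (range (\<lambda>bs. foldr Y bs F0))"
    by (simp add: image_image eval_y_word flip: eval.span_image)
  finally show ?thesis .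
qed

end

section \<open>Tensor products of evaluation modules\<close>

locale integral_weight = highest_weight \<psi> for \<psi> +
  fixes n :: nat and \<alpha> :: "nat \<Rightarrow> complex"
  assumes nonzero: "i \<in> {1..n} \<Longrightarrow> \<alpha> i \<noteq> 0"
    and weight: "\<psi> a = (\<Sum>i=1..n. \<alpha> i powi a)"
begin

text \<open>The operators below describe the action on the tensor product of the two-dimensional
  evaluation modules at the \<^term>\<open>\<alpha> i\<close>. A subset of \<^term>\<open>{1..n}\<close> records
  the tensor factors in which the lower basis vector occurs.\<close>

definition SX :: "int \<Rightarrow> (nat set \<Rightarrow> complex) \<Rightarrow> nat set \<Rightarrow> complex" where
  "SX a G S = (\<Sum>i\<in>{1..n} - S. \<alpha> i powi a * G (insert i S))"

definition SY :: "int \<Rightarrow> (nat set \<Rightarrow> complex) \<Rightarrow> nat set \<Rightarrow> complex" where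
  "SY a G S = (\<Sum>i\<in>{1..n} \<inter> S. \<alpha> i powi a * G (S - {i}))"

definition SW :: "int \<Rightarrow> (nat set \<Rightarrow> complex) \<Rightarrow> nat set \<Rightarrow> complex" where
  "SW a G S = ((\<Sum>i\<in>{1..n} - S. \<alpha> i powi a) - (\<Sum>i\<in>{1..n} \<inter> S. \<alpha> i powi a)) * G S"

definition G0 :: "nat set \<Rightarrow> complex" where
  "G0 S = (if S = {} then 1 else 0)"

lemma SX_add: "SX a (G + H) = SX a G + SX a H"
  by (rule ext) (simp add: SX_def algebra_simps sum.distrib)

lemma SX_scale: "SX a (fscale c G) = fscale c (SX a G)"
  by (rule ext) (simp add: SX_def sum_distrib_left algebra_simps)

lemma SX_G0: "SX a G0 = 0"
  by (rule ext) (simp add: SX_def G0_def)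

lemma SX_SX: "SX a (SX b G) = SX b (SX a G)"
proof
  fix S
  \<comment> \<open>The diagonal is kept with value 0, so that both indices run over the same set
    and the sums can be interchanged.\<close>
  have *: "SX a (SX b G) S = (\<Sum>i\<in>{1..n} - S. \<Sum>j\<in>{1..n} - S.
      if i = j then 0 else \<alpha> i powi a * (\<alpha> j powi b * G (insert i (insert j S))))" for a b
  proof -
    have "(\<Sum>j\<in>{1..n} - insert i S. \<alpha> j powi b * G (insert j (insert i S)))
      = (\<Sum>j\<in>{1..n} - S. if i = j then 0 else \<alpha> j powi b * G (insert i (insert j S)))" for i
      by (rule sum.mono_neutral_cong_left) (auto simp: insert_commute)
    then show ?thesis
      unfolding SX_def by (auto simp: sum_distrib_left intro!: sum.cong)
  qed
  show "SX a (SX b G) S = SX b (SX a G) S"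
    unfolding *[of a b] *[of b a]
    by (subst sum.swap) (auto simp: insert_commute intro!: sum.cong)
qed

text \<open>Inserting \<open>i\<close> into \<open>S\<close> moves \<open>\<alpha> i powi b\<close>
  from the positive to the negative part of the weight, which drops by twice this amount.\<close>

lemma SX_SW: "SX a (SW b G) = SW b (SX a G) + fscale (- 2) (SX (a + b) G)"
proof
  fix S
  have "(\<Sum>k\<in>{1..n} - insert i S. \<alpha> k powi b) - (\<Sum>k\<in>{1..n} \<inter> insert i S. \<alpha> k powi b)
      = (\<Sum>k\<in>{1..n} - S. \<alpha> k powi b) - (\<Sum>k\<in>{1..n} \<inter> S. \<alpha> k powi b) - 2 * \<alpha> i powi b"
    if "i \<in> {1..n} - S" for i
  proof -
    have eq: "{1..n} - S = insert i ({1..n} - insert i S)"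
      "{1..n} \<inter> insert i S = insert i ({1..n} \<inter> S)"
      using that by auto
    have "(\<Sum>k\<in>{1..n} - S. \<alpha> k powi b) = \<alpha> i powi b + (\<Sum>k\<in>{1..n} - insert i S. \<alpha> k powi b)"
      by (subst eq(1)) simp
    moreover have "(\<Sum>k\<in>{1..n} \<inter> insert i S. \<alpha> k powi b)
        = \<alpha> i powi b + (\<Sum>k\<in>{1..n} \<inter> S. \<alpha> k powi b)"
      unfolding eq(2) using that by simp
    ultimately show ?thesis by simp
  qed
  then have "SX a (SW b G) S = (\<Sum>i\<in>{1..n} - S. \<alpha> i powi a *
      (((\<Sum>k\<in>{1..n} - S. \<alpha> k powi b) - (\<Sum>k\<in>{1..n} \<inter> S. \<alpha> k powi b) - 2 * \<alpha> i powi b)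
        * G (insert i S)))"
    unfolding SX_def SW_def by (intro sum.cong refl) simp
  also have "\<dots> = (SW b (SX a G) + fscale (- 2) (SX (a + b) G)) S"
  proof -
    have *: "\<alpha> i powi a * ((w - 2 * \<alpha> i powi b) * G (insert i S))
      = w * (\<alpha> i powi a * G (insert i S)) - 2 * (\<alpha> i powi (a + b) * G (insert i S))"
      if "i \<in> {1..n} - S" for i w
    proof -
      have "\<alpha> i powi (a + b) = \<alpha> i powi a * \<alpha> i powi b"
        using that nonzero[of i] by (simp add: power_int_add)
      then show ?thesis by (simp add: algebra_simps)
    qed
    have "(\<Sum>i\<in>{1..n} - S. \<alpha> i powi a * ((w - 2 * \<alpha> i powi b) * G (insert i S)))
      = w * (\<Sum>i\<in>{1..n} - S. \<alpha> i powi a * G (insert i S))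
        - 2 * (\<Sum>i\<in>{1..n} - S. \<alpha> i powi (a + b) * G (insert i S))" for w
      unfolding sum_distrib_left sum_subtractf[symmetric] by (intro sum.cong refl *)
    then show ?thesis by (simp add: SX_def SW_def)
  qed
  finally show "SX a (SW b G) S = (SW b (SX a G) + fscale (- 2) (SX (a + b) G)) S" .
qed

text \<open>The terms with two different indices form \<open>?D\<close> in both composites and
  cancel. The diagonal terms give the sum outside \<open>S\<close> on one side and the sum inside
  \<open>S\<close> on the other, whose difference is the weight.\<close>

lemma SX_SY: "SX a (SY b G) = SY b (SX a G) + SW (a + b) G"
proof
  fix S
  let ?D = "\<Sum>i\<in>{1..n} - S. \<Sum>j\<in>{1..n} \<inter> S.
    \<alpha> i powi a * (\<alpha> j powi b * G (insert i (S - {j})))"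
  have "SX a (SY b G) S = (\<Sum>i\<in>{1..n} - S. \<alpha> i powi (a + b) * G S +
      (\<Sum>j\<in>{1..n} \<inter> S. \<alpha> i powi a * (\<alpha> j powi b * G (insert i (S - {j})))))"
    unfolding SX_def SY_def
  proof (intro sum.cong refl)
    fix i assume i: "i \<in> {1..n} - S"
    then have 1: "{1..n} \<inter> insert i S = insert i ({1..n} \<inter> S)" by auto
    have 2: "(\<Sum>j\<in>{1..n} \<inter> S. \<alpha> j powi b * G (insert i S - {j}))
        = (\<Sum>j\<in>{1..n} \<inter> S. \<alpha> j powi b * G (insert i (S - {j})))"
      by (intro sum.cong refl) (use i in \<open>auto simp: insert_Diff_if\<close>)
    have 3: "insert i S - {i} = S" using i by auto
    show "\<alpha> i powi a * (\<Sum>j\<in>{1..n} \<inter> insert i S. \<alpha> j powi b * G (insert i S - {j}))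
      = \<alpha> i powi (a + b) * G S
        + (\<Sum>j\<in>{1..n} \<inter> S. \<alpha> i powi a * (\<alpha> j powi b * G (insert i (S - {j}))))"
      using i nonzero[of i]
      by (simp add: 1 2[simplified] 3 power_int_add sum_distrib_left algebra_simps)
  qed
  then have X: "SX a (SY b G) S = (\<Sum>i\<in>{1..n} - S. \<alpha> i powi (a + b)) * G S + ?D"
    by (simp only: sum.distrib sum_distrib_right)
  have "SY b (SX a G) S = (\<Sum>j\<in>{1..n} \<inter> S. \<alpha> j powi (a + b) * G S +
      (\<Sum>i\<in>{1..n} - S. \<alpha> i powi a * (\<alpha> j powi b * G (insert i (S - {j})))))"
    unfolding SX_def SY_def
  proof (intro sum.cong refl)
    fix j assume j: "j \<in> {1..n} \<inter> S"
    then have "{1..n} - (S - {j}) = insert j ({1..n} - S)" "insert j (S - {j}) = S" by auto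
    then have 1: "(\<Sum>i\<in>{1..n} - (S - {j}). \<alpha> i powi a * G (insert i (S - {j})))
      = \<alpha> j powi a * G S + (\<Sum>i\<in>{1..n} - S. \<alpha> i powi a * G (insert i (S - {j})))"
      using j by simp
    have 2: "\<alpha> j powi (a + b) = \<alpha> j powi a * \<alpha> j powi b"
      using j nonzero[of j] by (simp add: power_int_add)
    show "\<alpha> j powi b * (\<Sum>i\<in>{1..n} - (S - {j}). \<alpha> i powi a * G (insert i (S - {j})))
      = \<alpha> j powi (a + b) * G S
        + (\<Sum>i\<in>{1..n} - S. \<alpha> i powi a * (\<alpha> j powi b * G (insert i (S - {j}))))"
      unfolding 1 2 distrib_left sum_distrib_left by (simp add: mult_ac)
  qed
  then have Y: "SY b (SX a G) S = (\<Sum>i\<in>{1..n} \<inter> S. \<alpha> i powi (a + b)) * G S + ?D"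
    by (simp only: sum.distrib sum_distrib_right sum.swap[where A = "{1..n} \<inter> S" and B = "{1..n} - S"])
  show "SX a (SY b G) S = (SY b (SX a G) + SW (a + b) G) S"
    by (simp add: X Y SW_def algebra_simps)
qed

lemma SX_comp_fun_commute: "comp_fun_commute SX"
  by unfold_locales (rule ext, simp only: o_apply, rule SX_SX)

interpretation SX: comp_fun_commute SX
  by (rule SX_comp_fun_commute)

text \<open>A matrix coefficient: the highest weight coordinate of the product of the commuting
  operators \<open>SX a\<close>, with \<open>a\<close> running over \<open>A\<close>, applied to
  \<open>G\<close>. It intertwines the actions; only its image matters below.\<close>

definition embed :: "(nat set \<Rightarrow> complex) \<Rightarrow> mfun" where
  "embed G A = fold_mset SX G A {}"

lemma embed_empty [simp]: "embed G {#} = G {}"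
  by (simp add: embed_def)

lemma embed_add_mset: "embed G (add_mset a A) = embed (SX a G) A"
  by (simp add: embed_def SX.fold_mset_fun_left_comm)

lemma X_embed: "X a (embed G) = embed (SX a G)"
  by (rule ext) (simp add: X_apply embed_add_mset)

lemma embed_add: "embed (G + H) = embed G + embed H"
proof
  fix A show "embed (G + H) A = (embed G + embed H) A"
    by (induction A arbitrary: G H) (simp_all add: embed_add_mset SX_add)
qed

lemma embed_scale: "embed (fscale c G) = fscale c (embed G)"
proof
  fix A show "embed (fscale c G) A = fscale c (embed G) A"
    by (induction A arbitrary: G) (simp_all add: embed_add_mset SX_scale)
qed

sublocale embed: Vector_Spaces.linear fscale fscale embed
  by unfold_locales (simp_all add: embed_add embed_scale)

lemma embed_G0: "embed G0 = F0"
proof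
  fix A show "embed G0 A = F0 A"
    by (cases A) (simp_all add: G0_def F0_def embed_add_mset SX_G0 embed.zero)
qed

text \<open>Both sides satisfy the same recursion in \<open>A\<close>. At the empty multiset the
  claim is the hypothesis \<open>weight\<close>: the empty set of factors has weight
  \<open>\<psi> b\<close>.\<close>

lemma W_embed: "W b (embed G) = embed (SW b G)"
proof
  fix A show "W b (embed G) A = embed (SW b G) A"
    by (induction A arbitrary: G)
      (simp_all add: SW_def weight W_add_mset X_embed embed_add_mset SX_SW embed_add embed_scale embed.diff)
qed

lemma Y_embed: "Y b (embed G) = embed (SY b G)"
proof
  fix A show "Y b (embed G) A = embed (SY b G) A"
    by (induction A arbitrary: G)
      (simp_all add: SY_def Y_add_mset X_embed W_embed embed_add_mset SX_SY embed_add)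
qed

lemma SY_supported: "foldr SY bs G0 S \<noteq> 0 \<Longrightarrow> S \<subseteq> {1..n}"
proof (induction bs arbitrary: S)
  case Nil
  then show ?case by (auto simp: G0_def split: if_splits)
next
  case (Cons b bs)
  then have "SY b (foldr SY bs G0) S \<noteq> 0" by simp
  then obtain i where "i \<in> {1..n} \<inter> S" "foldr SY bs G0 (S - {i}) \<noteq> 0"
    unfolding SY_def[of b] by (metis (no_types, lifting) mult_zero_right sum.neutral)
  then show ?case using Cons.IH[of "S - {i}"] by auto
qed

text \<open>All products of the \<open>SY b\<close> on \<open>G0\<close> are supported on subsets of
  \<open>{1..n}\<close>, so the images of the point functions of these subsets suffice.\<close>

lemma Y_words_finite_span:
  "\<exists>B. finite B \<and> fs.span (range (\<lambda>bs. foldr Y bs F0)) \<subseteq> fs.span B"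
proof -
  define \<delta> where "\<delta> = (\<lambda>S T :: nat set. if T = S then 1 else 0 :: complex)"
  let ?B = "embed ` \<delta> ` Pow {1..n}"
  have "foldr Y bs F0 \<in> fs.span ?B" for bs
  proof -
    let ?G = "foldr SY bs G0"
    have "foldr Y bs F0 = embed ?G"
      by (induction bs) (simp_all add: embed_G0 Y_embed)
    also have "?G = (\<Sum>S\<in>Pow {1..n}. fscale (?G S) (\<delta> S))"
    proof
      fix T
      have "(\<Sum>S\<in>Pow {1..n}. fscale (?G S) (\<delta> S)) T = (\<Sum>S\<in>Pow {1..n}. if T = S then ?G S else 0)"
        unfolding sum_fun_apply by (intro sum.cong refl) (simp add: \<delta>_def)
      also have "\<dots> = ?G T" using SY_supported[of bs T] by (subst sum.delta') auto
      finally show "?G T = (\<Sum>S\<in>Pow {1..n}. fscale (?G S) (\<delta> S)) T" ..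
    qed
    also have "embed \<dots> \<in> fs.span ?B"
      unfolding embed.sum embed_scale
      by (intro fs.span_sum fs.span_scale fs.span_base imageI)
    finally show ?thesis .
  qed
  then have "fs.span (range (\<lambda>bs. foldr Y bs F0)) \<subseteq> fs.span ?B"
    by (intro fs.span_minimal fs.subspace_span) auto
  then show ?thesis by (intro exI[of _ ?B]) simp
qed

end

section \<open>Joint eigenfunctions of shifts\<close>

definition shift :: "nat \<Rightarrow> int \<Rightarrow> (nat \<Rightarrow> int) \<Rightarrow> nat \<Rightarrow> int" where
  "shift k e b = b(k := b k + e)"

lemma shift_shift: "shift k e (shift k f b) = shift k (f + e) b"
  and shift_commute: "shift i c (shift k e b) = shift k e (shift i c b)"
  and shift_zero [simp]: "shift k 0 b = b"
  by (auto simp: shift_def fun_eq_iff)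

text \<open>With s the shift of coordinate \<open>k\<close>, this is the factorization p(s) = q(s)
  (s - \<alpha>) applied to \<open>U\<close>.\<close>

lemma poly_shift_factor:
  fixes q :: "complex poly" and U :: "(nat \<Rightarrow> int) \<Rightarrow> complex"
  assumes "p = [:- \<alpha>, 1:] * q" "q \<noteq> 0"
  shows "(\<Sum>j\<le>degree p. coeff p j * U (shift k (int j) b))
    = (\<Sum>j\<le>degree q. coeff q j *
        (U (shift k 1 (shift k (int j) b)) - \<alpha> * U (shift k (int j) b)))"
proof -
  let ?f = "\<lambda>j. U (shift k (int j) b)"
  have deg: "degree p = Suc (degree q)"
    unfolding assms(1) using assms(2) by (subst degree_mult_eq) auto
  have "p = pCons 0 q - smult \<alpha> q" by (simp add: assms(1))
  then have coeff: "coeff p j = coeff (pCons 0 q) j - \<alpha> * coeff q j" for j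
    by (simp only: coeff_diff coeff_smult)
  have "(\<Sum>j\<le>degree p. coeff p j * ?f j)
    = (\<Sum>j\<le>Suc (degree q). coeff (pCons 0 q) j * ?f j) - (\<Sum>j\<le>Suc (degree q). \<alpha> * coeff q j * ?f j)"
    by (simp only: deg coeff left_diff_distrib sum_subtractf)
  also have "(\<Sum>j\<le>Suc (degree q). coeff (pCons 0 q) j * ?f j) = (\<Sum>j\<le>degree q. coeff q j * ?f (Suc j))"
    by (simp add: sum.atMost_Suc_shift del: sum.atMost_Suc)
  also have "(\<Sum>j\<le>Suc (degree q). \<alpha> * coeff q j * ?f j) = (\<Sum>j\<le>degree q. \<alpha> * coeff q j * ?f j)"
    by (simp add: coeff_eq_0)
  finally show ?thesis
    by (simp add: shift_shift sum_subtractf[symmetric] algebra_simps)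
qed

text \<open>Linear factors of \<open>p\<close> are split off one at a time: either s - \<alpha>
  kills \<open>U\<close>, which is then an eigenfunction, or it gives a nonzero function killed by a
  polynomial of smaller degree. \<open>Q\<close> collects properties that survive this step.\<close>

lemma shift_eigenfunction:
  fixes U :: "(nat \<Rightarrow> int) \<Rightarrow> complex"
  assumes closed: "\<And>U \<alpha>. Q U \<Longrightarrow> Q (\<lambda>b. U (shift k 1 b) - \<alpha> * U b)"
    and "Q U" "U b0 \<noteq> 0" "p \<noteq> 0" "\<And>b. (\<Sum>j\<le>degree p. coeff p j * U (shift k (int j) b)) = 0"
  shows "\<exists>V \<alpha>. Q V \<and> (\<exists>b. V b \<noteq> 0) \<and> \<alpha> \<noteq> 0 \<and> (\<forall>b. V (shift k 1 b) = \<alpha> * V b)"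
  using assms(2-)
proof (induction "degree p" arbitrary: p U b0)
  case 0
  then have "coeff p 0 \<noteq> 0" by (metis leading_coeff_0_iff)
  then show ?case using 0(1,3,5)[of ] 0(5)[of b0] by simp
next
  case (Suc m)
  obtain \<alpha> where "poly p \<alpha> = 0"
    using Suc(2) fundamental_theorem_of_algebra[of p] by (auto simp: constant_degree)
  then obtain q where q: "p = [:- \<alpha>, 1:] * q" by (auto simp: poly_eq_0_iff_dvd dvd_def)
  have q0: "q \<noteq> 0" using Suc(5) q by auto
  have deg: "m = degree q"
    using Suc(2) q0 unfolding q by (subst (asm) degree_mult_eq) auto
  let ?V = "\<lambda>b. U (shift k 1 b) - \<alpha> * U b"
  show ?case
  proof (cases "\<exists>b. ?V b \<noteq> 0")
    case True
    then obtain b1 where "?V b1 \<noteq> 0" by blast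
    moreover have "(\<Sum>j\<le>degree q. coeff q j * ?V (shift k (int j) b)) = 0" for b
      using Suc(6)[of b] poly_shift_factor[OF q q0, of U k b] by simp
    ultimately show ?thesis using Suc(1)[OF deg closed[OF Suc(3)] _ q0] by blast
  next
    case False
    then have eig: "U (shift k 1 b) = \<alpha> * U b" for b by simp
    \<comment> \<open>Shifts are invertible: \<open>U b0\<close> is \<alpha> times the value of
      \<open>U\<close> at the point shifted back.\<close>
    have "\<alpha> \<noteq> 0" using eig[of "shift k (- 1) b0"] Suc(4) by (auto simp: shift_shift)
    then show ?thesis using Suc(3,4) eig by blast
  qed
qed

lemma shift_eigenfunction_power:
  fixes V :: "(nat \<Rightarrow> int) \<Rightarrow> complex"
  assumes "\<alpha> \<noteq> 0" "\<And>b. V (shift k 1 b) = \<alpha> * V b"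
  shows "V (shift k e b) = \<alpha> powi e * V b"
proof (induction e rule: int_induct[of _ 0])
  case base
  show ?case by simp
next
  case (step1 i)
  then show ?case
    using assms(2)[of "shift k i b"] assms(1) by (simp add: shift_shift power_int_add)
next
  case (step2 i)
  then show ?case
    using assms(2)[of "shift k (i - 1) b"] assms(1) by (simp add: shift_shift power_int_diff field_simps)
qed

text \<open>The hypotheses on \<open>T\<close> are linear and shift invariant, so they survive the
  passage to a joint eigenfunction of all \<open>d\<close> shifts. There the sum identity becomes
  the power sum formula after division by a nonzero value.\<close>

lemma power_sums_of_shift_identity:
  fixes T :: "(nat \<Rightarrow> int) \<Rightarrow> complex"
  assumes T: "T b0 \<noteq> 0"
    and sum: "\<And>b e. (\<Sum>i<d. T (shift i e b)) = \<psi> e * T b"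
    and p: "p \<noteq> 0" "\<And>i b. i < d \<Longrightarrow> (\<Sum>j\<le>degree p. coeff p j * T (shift i (int j) b)) = 0"
  shows "\<exists>\<alpha>. (\<forall>i<d. \<alpha> i \<noteq> 0) \<and> (\<forall>e. \<psi> e = (\<Sum>i<d. \<alpha> i powi e))"
proof -
  define good where "good = (\<lambda>U. (\<forall>b e. (\<Sum>i<d. U (shift i e b)) = \<psi> e * U b) \<and>
    (\<forall>i<d. \<forall>b. (\<Sum>j\<le>degree p. coeff p j * U (shift i (int j) b)) = 0))"
  have closed: "good (\<lambda>b. U (shift k 1 b) - \<alpha> * U b)" if U: "good U" for U k \<alpha>
  proof -
    have "(\<Sum>i<d. U (shift k 1 (shift i e b))) = \<psi> e * U (shift k 1 b)" for e b
      using U by (simp add: good_def shift_commute[of k])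
    moreover have "(\<Sum>j\<le>degree p. coeff p j * U (shift k 1 (shift i (int j) b))) = 0" if "i < d" for i b
      using U that by (simp add: good_def shift_commute[of k])
    moreover have "(\<Sum>j\<le>degree p. coeff p j * (\<alpha> * U (shift i (int j) b))) = 0" if "i < d" for i b
    proof -
      have "(\<Sum>j\<le>degree p. coeff p j * (\<alpha> * U (shift i (int j) b)))
        = \<alpha> * (\<Sum>j\<le>degree p. coeff p j * U (shift i (int j) b))"
        by (simp add: sum_distrib_left algebra_simps)
      then show ?thesis using U that by (simp add: good_def)
    qed
    ultimately show ?thesis
      using U by (simp add: good_def sum_subtractf right_diff_distrib flip: sum_distrib_left)
  qed
  have "\<exists>U \<alpha>. good U \<and> (\<exists>b. U b \<noteq> 0) \<and> (\<forall>k<m. \<alpha> k \<noteq> 0 \<and> (\<forall>b. U (shift k 1 b) = \<alpha> k * U b))"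
    if "m \<le> d" for m
    using that
  proof (induction m)
    case 0
    have "good T" using sum p by (simp add: good_def)
    then show ?case using T by auto
  next
    case (Suc m)
    then obtain U \<alpha> b where U: "good U" "U b \<noteq> 0"
      "\<And>k. k < m \<Longrightarrow> \<alpha> k \<noteq> 0" "\<And>k b. k < m \<Longrightarrow> U (shift k 1 b) = \<alpha> k * U b"
      by (metis Suc_leD)
    \<comment> \<open>The eigenvalue equations for earlier coordinates are kept, since the shifts
      commute.\<close>
    define Q where "Q = (\<lambda>U. good U \<and> (\<forall>k<m. \<forall>b. U (shift k 1 b) = \<alpha> k * U b))"
    have "Q (\<lambda>b. U (shift m 1 b) - \<beta> * U b)" if "Q U" for U \<beta>
      using that closed by (simp add: Q_def shift_commute[of m] algebra_simps)
    moreover have "Q U" using U by (simp add: Q_def)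
    moreover have "(\<Sum>j\<le>degree p. coeff p j * U (shift m (int j) b)) = 0" for b
      using U(1) Suc(2) by (simp add: good_def)
    ultimately obtain V \<beta> where "Q V" "\<exists>b. V b \<noteq> 0" "\<beta> \<noteq> 0" "\<forall>b. V (shift m 1 b) = \<beta> * V b"
      using shift_eigenfunction[of Q m U b p] U(2) p(1) by blast
    then show ?case using U(3)
      by (intro exI[of _ V] exI[of _ "\<alpha>(m := \<beta>)"]) (auto simp: Q_def less_Suc_eq)
  qed
  from this[of d] obtain U \<alpha> b where U: "good U" "U b \<noteq> 0"
    and \<alpha>: "\<And>k. k < d \<Longrightarrow> \<alpha> k \<noteq> 0" "\<And>k b. k < d \<Longrightarrow> U (shift k 1 b) = \<alpha> k * U b"
    by (metis order_refl)
  have "\<psi> e = (\<Sum>i<d. \<alpha> i powi e)" for e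
  proof -
    have "\<psi> e * U b = (\<Sum>i<d. U (shift i e b))" using U(1) by (simp add: good_def)
    also have "\<dots> = (\<Sum>i<d. \<alpha> i powi e * U b)"
      using \<alpha> by (intro sum.cong refl shift_eigenfunction_power) auto
    finally have "\<psi> e * U b = (\<Sum>i<d. \<alpha> i powi e * U b)" .
    then show ?thesis using U(2) by (simp flip: sum_distrib_right)
  qed
  then show ?thesis using \<alpha>(1) by blast
qed

section \<open>Finite-dimensional highest weight modules\<close>

text \<open>An injective sequence has an infinite, hence dependent, range; a repeated value gives a
  relation with coefficients 1 and -1.\<close>

lemma finite_span_relation:
  fixes f :: "nat \<Rightarrow> 'a \<Rightarrow> complex"
  assumes B: "finite B" "range f \<subseteq> fs.span B"
  obtains N c where "\<exists>j\<le>N. c j \<noteq> 0" "(\<Sum>j\<le>N. fscale (c j) (f j)) = 0"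
proof (cases "inj f")
  case True
  have "infinite (range f)" using True by (simp add: range_inj_infinite)
  then have "fs.dependent (range f)"
    using fs.independent_span_bound[OF B(1) _ B(2)] by blast
  then obtain t u where t: "finite t" "t \<subseteq> range f" "\<exists>v\<in>t. u v \<noteq> 0" "(\<Sum>v\<in>t. fscale (u v) v) = 0"
    unfolding fs.dependent_explicit by blast
  obtain J where J: "finite J" "t = f ` J"
    using finite_subset_image[OF t(1,2)] by auto
  define c where "c = (\<lambda>j. if j \<in> J then u (f j) else 0)"
  have J': "J \<subseteq> {..Max (insert 0 J)}" using J(1) by auto
  have "(\<Sum>j\<le>Max (insert 0 J). fscale (c j) (f j)) = (\<Sum>j\<in>J. fscale (u (f j)) (f j))"
    using J' by (intro sum.mono_neutral_cong_right) (auto simp: c_def)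
  also have "\<dots> = 0"
    using t(4) True by (simp add: J sum.reindex inj_on_def)
  finally have "(\<Sum>j\<le>Max (insert 0 J). fscale (c j) (f j)) = 0" .
  moreover have "\<exists>j\<le>Max (insert 0 J). c j \<noteq> 0"
    using t(3) J J' by (auto simp: c_def)
  ultimately show ?thesis by (rule that[rotated])
next
  case False
  then obtain j k where jk: "f j = f k" "j < k"
    unfolding inj_def by (metis linorder_neqE_nat)
  define c where "c = (\<lambda>i. if i = j then 1 else if i = k then - 1 else 0 :: complex)"
  have "(\<Sum>i\<le>k. fscale (c i) (f i)) = (\<Sum>i\<in>{j, k}. fscale (c i) (f i))"
    using jk(2) by (intro sum.mono_neutral_right) (auto simp: c_def)
  also have "\<dots> = 0" using jk by (simp add: c_def)
  finally have "(\<Sum>i\<le>k. fscale (c i) (f i)) = 0" .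
  moreover have "\<exists>i\<le>k. c i \<noteq> 0" by (intro exI[of _ k]) (simp add: c_def)
  ultimately show ?thesis by (rule that[rotated])
qed

lemmas fun_applies = plus_fun_apply zero_fun_apply minus_apply uminus_apply fscale_apply

context highest_weight
begin

abbreviation "Ys bs \<equiv> foldr Y bs F0"

text \<open>The dual form of a weight space: on such functions \<open>W 0\<close> is the scalar
  \<open>\<psi> 0 - 2 k\<close>.\<close>

definition supported :: "nat \<Rightarrow> mfun \<Rightarrow> bool" where
  "supported k F \<longleftrightarrow> (\<forall>A. size A \<noteq> k \<longrightarrow> F A = 0)"

text \<open>Each term of \<open>Y b F A\<close> evaluates \<open>F\<close> at a multiset with one
  element fewer: one is removed, or two are merged into one.\<close>

lemma supported_Y: "supported k F \<Longrightarrow> supported (Suc k) (Y b F)"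
  unfolding supported_def Y_op_def
proof (intro allI impI)
  fix A :: "int multiset"
  assume F: "\<forall>A. size A \<noteq> k \<longrightarrow> F A = 0" and A: "size A \<noteq> Suc k"
  have 1: "\<psi> (a + b) * F (A - {#a#}) = 0" if "a \<in># A" for a
  proof -
    have "size (A - {#a#}) \<noteq> k" using that A by (metis insert_DiffM size_add_mset)
    then show ?thesis using F by simp
  qed
  have 2: "F (add_mset (a + b + c) (A - {#a#} - {#c#})) = 0" if "a \<in># A" "c \<in># A - {#a#}" for a c
  proof -
    have "size (add_mset (a + b + c) (A - {#a#} - {#c#})) \<noteq> k"
      using that A by (metis insert_DiffM size_add_mset)
    then show ?thesis using F by simp
  qed
  have "(\<Sum>a\<in>#A. \<psi> (a + b) * F (A - {#a#})) = (\<Sum>a\<in>#A. 0)"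
    by (intro arg_cong[where f = sum_mset] image_mset_cong 1)
  moreover have "(\<Sum>a\<in>#A. \<Sum>c\<in>#A - {#a#}. F (add_mset (a + b + c) (A - {#a#} - {#c#})))
     = (\<Sum>a\<in>#A. \<Sum>c\<in>#A - {#a#}. 0)"
    by (intro arg_cong[where f = sum_mset] image_mset_cong 2)
  ultimately show "(\<Sum>a\<in>#A. \<psi> (a + b) * F (A - {#a#})) -
     (\<Sum>a\<in>#A. \<Sum>c\<in>#A - {#a#}. F (add_mset (a + b + c) (A - {#a#} - {#c#}))) = 0"
    by simp
qed

lemma supported_Ys: "supported (length bs) (Ys bs)"
proof (induction bs)
  case Nil
  show ?case by (auto simp: supported_def F0_def)
next
  case (Cons b bs)
  then show ?case using supported_Y by simp
qed

lemma foldr_Y_zero [simp]: "foldr Y bs 0 = 0"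
  by (induction bs) (simp_all del: fun_applies)

lemma foldr_Y_scale: "foldr Y bs (fscale c F) = fscale c (foldr Y bs F)"
  by (induction bs) (simp_all add: Y_scale del: fun_applies)

lemma foldr_Y_sum: "foldr Y bs (sum f I) = (\<Sum>i\<in>I. foldr Y bs (f i))"
  by (induction bs) (simp_all add: Y_sum del: fun_applies)

lemma foldr_Y_commute: "foldr Y bs (Y a F) = Y a (foldr Y bs F)"
  by (induction bs) (simp_all add: Y_Y del: fun_applies)

lemma Y_F0_singleton: "Y b F0 {#a#} = \<psi> (a + b)"
  by (simp add: Y_add_mset F0_def)

text \<open>Moving \<open>W c\<close> to the right past a letter shifts that letter by
  \<open>c\<close> with factor -2, and on \<open>F0\<close> it is the scalar
  \<open>\<psi> c\<close>.\<close>

lemma W_Ys: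
  "W c (Ys bs) = fscale (\<psi> c) (Ys bs) - fscale 2 (\<Sum>i<length bs. Ys (bs[i := bs ! i + c]))"
proof (induction bs)
  case Nil
  show ?case by simp
next
  case (Cons b bs)
  have sum: "(\<Sum>i<length (b # bs). Ys ((b # bs)[i := (b # bs) ! i + c]))
    = Ys ((b + c) # bs) + Y b (\<Sum>i<length bs. Ys (bs[i := bs ! i + c]))"
    by (simp add: sum.lessThan_Suc_shift Y_sum del: sum.lessThan_Suc fun_applies)
  have "W c (Ys (b # bs)) = Y b (W c (Ys bs)) - fscale 2 (Ys ((b + c) # bs))"
    by (simp add: W_Y add.commute del: fun_applies)
  then show ?case
    unfolding sum Cons.IH Y_diff Y_scale fs.scale_right_distrib by (simp del: fun_applies)
qed

section \<open>Strings for the sl_2-triple \<open>X 0\<close>, \<open>W 0\<close>,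
  \<open>Y 0\<close>\<close>

lemma W0_Y0_power: "W 0 ((Y 0 ^^ k) F0) = fscale (\<psi> 0 - 2 * of_nat k) ((Y 0 ^^ k) F0)"
proof (induction k)
  case 0
  show ?case by simp
next
  case (Suc k)
  then show ?case
    by (simp add: W_Y Y_scale algebra_simps del: fun_applies flip: fs.scale_left_diff_distrib)
qed

text \<open>The standard sl_2 computation; if \<open>Suc k\<close> is the first power of
  \<open>Y 0\<close> that kills \<open>F0\<close>, the scalar must vanish and
  \<open>\<psi> 0 = k\<close>.\<close>

lemma X0_Y0_power:
  "X 0 ((Y 0 ^^ Suc k) F0) = fscale (of_nat (Suc k) * (\<psi> 0 - of_nat k)) ((Y 0 ^^ k) F0)"
proof (induction k)
  case 0
  show ?case by (simp add: X_Y)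
next
  case (Suc k)
  have "X 0 ((Y 0 ^^ Suc (Suc k)) F0)
    = Y 0 (X 0 ((Y 0 ^^ Suc k) F0)) + W 0 ((Y 0 ^^ Suc k) F0)"
    by (simp only: funpow.simps o_apply X_Y add_0_left)
  also have "\<dots> = fscale (of_nat (Suc k) * (\<psi> 0 - of_nat k)) ((Y 0 ^^ Suc k) F0)
      + fscale (\<psi> 0 - 2 * of_nat (Suc k)) ((Y 0 ^^ Suc k) F0)"
    unfolding Suc W0_Y0_power Y_scale by simp
  also have "\<dots> = fscale (of_nat (Suc (Suc k)) * (\<psi> 0 - of_nat (Suc k))) ((Y 0 ^^ Suc k) F0)"
    unfolding fs.scale_left_distrib[symmetric] by (simp add: algebra_simps)
  finally show ?case .
qed

lemma Y_X: "Y b (X a F) = X a (Y b F) - W (a + b) F"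
  by (simp add: X_Y)

lemma X_power_apply: "(X a ^^ k) F A = F (A + replicate_mset k a)"
  by (induction k arbitrary: A) (simp_all add: X_apply)

lemma W0_X0_power:
  assumes "W 0 u = fscale \<mu> u"
  shows "W 0 ((X 0 ^^ k) u) = fscale (\<mu> + 2 * of_nat k) ((X 0 ^^ k) u)"
proof (induction k)
  case 0
  show ?case by (simp add: assms)
next
  case (Suc k)
  then show ?case
    by (simp add: W_X X_scale algebra_simps del: fun_applies flip: fs.scale_left_distrib)
qed

text \<open>The mirror image of \<open>X0_Y0_power\<close>, starting from a lowest weight vector of
  weight \<mu>.\<close>

lemma Y0_X0_power:
  assumes "W 0 u = fscale \<mu> u" "Y 0 u = 0"
  shows "Y 0 ((X 0 ^^ Suc k) u) = fscale (- of_nat (Suc k) * (\<mu> + of_nat k)) ((X 0 ^^ k) u)"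
proof (induction k)
  case 0
  show ?case by (simp add: Y_X assms)
next
  case (Suc k)
  have "Y 0 ((X 0 ^^ Suc (Suc k)) u)
    = X 0 (Y 0 ((X 0 ^^ Suc k) u)) - W 0 ((X 0 ^^ Suc k) u)"
    by (simp only: funpow.simps o_apply Y_X add_0_left)
  also have "\<dots> = fscale (- of_nat (Suc k) * (\<mu> + of_nat k)) ((X 0 ^^ Suc k) u)
      - fscale (\<mu> + 2 * of_nat (Suc k)) ((X 0 ^^ Suc k) u)"
    unfolding Suc W0_X0_power[OF assms(1)] X_scale by simp
  also have "\<dots> = fscale (- of_nat (Suc (Suc k)) * (\<mu> + of_nat (Suc k))) ((X 0 ^^ Suc k) u)"
    unfolding fs.scale_left_diff_distrib[symmetric] by (simp add: algebra_simps)
  finally show ?case .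
qed

text \<open>The truncated \<open>k - 1\<close> is harmless at \<open>k = 0\<close>, where the
  coefficient is zero.\<close>

lemma W_X0_power: "W c ((X 0 ^^ k) u) = (X 0 ^^ k) (W c u) + fscale (2 * of_nat k) (X c ((X 0 ^^ (k - 1)) u))"
proof (induction k)
  case 0
  show ?case by simp
next
  case (Suc k)
  show ?case
  proof (cases k)
    case 0
    then show ?thesis by (simp add: W_X)
  next
    case (Suc m)
    with Suc.IH show ?thesis
      by (simp add: W_X X_add X_scale X_X[of c 0] algebra_simps del: fun_applies flip: fs.scale_left_distrib)
  qed
qed

text \<open>This identity carries the action of the Weyl reflection from the lowest to the highest weight:
  where \<^term>\<open>X 0 ^^ Suc k\<close> vanishes, \<^term>\<open>X 0 ^^ k\<close> turns \<^term>\<open>W c\<close> into its negative.\<close>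

lemma Y_X0_power:
  assumes "Y c u = 0"
  shows "fscale 2 (Y c ((X 0 ^^ Suc k) u))
    = fscale (- of_nat (Suc k)) (W c ((X 0 ^^ k) u) + (X 0 ^^ k) (W c u))"
proof (induction k)
  case 0
  show ?case by (simp add: Y_X assms fun_eq_iff)
next
  case (Suc k)
  let ?x = "(X 0 ^^ Suc k) u" and ?z = "X c ((X 0 ^^ k) u)"
  have 1: "fscale 2 (Y c (X 0 ?x)) = X 0 (fscale 2 (Y c ?x)) - fscale 2 (W c ?x)"
    by (simp add: Y_X X_scale fs.scale_right_diff_distrib del: funpow.simps)
  have 2: "X 0 (W c ((X 0 ^^ k) u)) = W c ?x - fscale 2 ?z"
    by (simp add: W_X)
  have 3: "W c ?x = (X 0 ^^ Suc k) (W c u) + fscale (2 * of_nat (Suc k)) ?z"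
    using W_X0_power[of c "Suc k" u] by simp
  have 4: "X 0 ((X 0 ^^ k) (W c u)) = (X 0 ^^ Suc k) (W c u)" by simp
  have "fscale 2 (Y c (X 0 ?x)) = fscale (- of_nat (Suc k)) (W c ?x - fscale 2 ?z + (X 0 ^^ Suc k) (W c u))
     - fscale 2 (W c ?x)"
    unfolding 1 Suc X_scale X_add 2 4 ..
  \<comment> \<open>Fact 3 eliminates \<open>?z\<close>, since it expresses \<open>2 * Suc k\<close>
    times \<open>?z\<close> by the two terms with \<open>W c\<close>.\<close>
  also have "\<dots> = fscale (- of_nat (Suc (Suc k))) (W c ?x + (X 0 ^^ Suc k) (W c u))"
    unfolding 3 by (rule ext) (simp add: algebra_simps del: funpow.simps)
  finally show ?case by simp
qed

theorem power_sums_of_finite_span: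
  assumes B: "finite B" "range Ys \<subseteq> fs.span B"
  shows "\<exists>(n::nat) \<alpha>. (\<forall>i\<in>{1..n}. \<alpha> i \<noteq> 0) \<and> (\<forall>a. \<psi> a = (\<Sum>i=1..n. \<alpha> i powi a))"
proof -
  define Z where "Z = (\<lambda>k. \<forall>bs. length bs = k \<longrightarrow> Ys bs = 0)"
  \<comment> \<open>Otherwise there are nonzero products of every length; their supports are
    disjoint, which contradicts the finite span.\<close>
  have "\<exists>k. Z k"
  proof (rule ccontr)
    assume "\<nexists>k. Z k"
    then obtain g where g: "\<And>k. length (g k) = k" "\<And>k. Ys (g k) \<noteq> 0"
      unfolding Z_def by metis
    obtain N c where c: "\<exists>j\<le>N. c j \<noteq> 0" "(\<Sum>j\<le>N. fscale (c j) (Ys (g j))) = 0"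
      using finite_span_relation[OF B(1), of "\<lambda>j. Ys (g j)"] B(2) by blast
    then obtain k where k: "k \<le> N" "c k \<noteq> 0" by blast
    obtain A where A: "Ys (g k) A \<noteq> 0" using g(2)[of k] by (auto simp: fun_eq_iff)
    have sz: "size A = k" using A supported_Ys[of "g k"] g(1)[of k] unfolding supported_def by metis
    have "0 = (\<Sum>j\<le>N. fscale (c j) (Ys (g j))) A" by (simp add: c(2))
    also have "\<dots> = (\<Sum>j\<le>N. if j = k then c k * Ys (g k) A else 0)"
      unfolding sum_fun_apply
      using supported_Ys g(1) sz by (intro sum.cong refl) (auto simp: supported_def)
    also have "\<dots> = c k * Ys (g k) A" using k(1) by simp
    finally show False using k(2) A by simp
  qed
  moreover have "\<not> Z 0" by (simp add: Z_def F0_def fun_eq_iff exI[of _ "{#}"])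
  ultimately obtain d where d: "\<not> Z d" "Z (Suc d)"
    using ex_least_nat_less[of Z] by blast
  then obtain bs0 where bs0: "length bs0 = d" "Ys bs0 \<noteq> 0" by (auto simp: Z_def)
  have Y_kill: "Y c (Ys bs) = 0" if "length bs = d" for bs c
    using d(2) that unfolding Z_def by (metis foldr.simps(2) length_Cons o_apply)
  \<comment> \<open>A multiset with \<open>Suc d\<close> added zeros is too large for the
    support.\<close>
  have X_kill: "(X 0 ^^ Suc d) (Ys bs) = 0" if "length bs = d" for bs
    using supported_Ys[of bs] that
    by (intro ext) (simp add: X_power_apply supported_def del: funpow.simps)

  \<comment> \<open>The string down from \<open>F0\<close> stops after \<open>k\<close> steps, so
    \<open>\<psi> 0 = k\<close>. The string up from the lowest weight vector \<open>Ys bs0\<close>,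
    of weight \<open>k - 2 d\<close>, stops after \<open>l = 2 d - k\<close> steps. Both lengths are
    at most \<open>d\<close>, so both equal \<open>d\<close>.\<close>
  have d0: "\<psi> 0 = of_nat d" and X_d: "(X 0 ^^ d) (Ys bs0) \<noteq> 0"
  proof -
    have "(Y 0 ^^ k) F0 = Ys (replicate k 0)" for k by (induction k) auto
    then have "(Y 0 ^^ Suc d) F0 = 0" using d(2) unfolding Z_def by (metis length_replicate)
    moreover have "(Y 0 ^^ 0) F0 \<noteq> 0" by (simp add: F0_def fun_eq_iff exI[of _ "{#}"])
    ultimately obtain k where k: "k < Suc d" "(Y 0 ^^ k) F0 \<noteq> 0" "(Y 0 ^^ Suc k) F0 = 0"
      using ex_least_nat_less[of "\<lambda>k. (Y 0 ^^ k) F0 = 0" "Suc d"] by blast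
    have "fscale (of_nat (Suc k) * (\<psi> 0 - of_nat k)) ((Y 0 ^^ k) F0) = 0"
      using X0_Y0_power[of k] unfolding k(3) by simp
    then have psi: "\<psi> 0 = of_nat k" using k(2) by (simp del: of_nat_Suc)
    have W0: "W 0 (Ys bs0) = fscale (\<psi> 0 - 2 * of_nat d) (Ys bs0)"
    proof -
      have "Ys (bs0[i := bs0 ! i + 0]) = Ys bs0" for i by simp
      then show ?thesis unfolding W_Ys[of 0]
        by (intro ext) (simp add: sum_fun_apply bs0 algebra_simps)
    qed
    have "(X 0 ^^ Suc d) (Ys bs0) = 0" by (rule X_kill[OF bs0(1)])
    moreover have "(X 0 ^^ 0) (Ys bs0) \<noteq> 0" using bs0 by simp
    ultimately obtain l where l: "l < Suc d" "(X 0 ^^ l) (Ys bs0) \<noteq> 0" "(X 0 ^^ Suc l) (Ys bs0) = 0"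
      using ex_least_nat_less[of "\<lambda>k. (X 0 ^^ k) (Ys bs0) = 0" "Suc d"] by blast
    have "fscale (- of_nat (Suc l) * (\<psi> 0 - 2 * of_nat d + of_nat l)) ((X 0 ^^ l) (Ys bs0)) = 0"
      using Y0_X0_power[OF W0 Y_kill[OF bs0(1)], of l] unfolding l(3) by simp
    then have "\<psi> 0 - 2 * of_nat d + of_nat l = 0" using l(2) by (simp del: of_nat_Suc)
    then have "(of_nat (k + l) :: complex) = of_nat (2 * d)" by (simp add: psi algebra_simps)
    then have "k + l = 2 * d" using of_nat_eq_iff by blast
    then have "k = d" "l = d" using k(1) l(1) by auto
    then show "\<psi> 0 = of_nat d" "(X 0 ^^ d) (Ys bs0) \<noteq> 0" using psi l(2) by auto
  qed

  define z where "z = replicate_mset d (0 :: int)"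
  \<comment> \<open>The support leaves room only for the empty multiset next to the \<open>d\<close>
    zeros.\<close>
  have z_nonzero: "Ys bs0 z \<noteq> 0"
  proof -
    obtain A where A: "Ys bs0 (A + z) \<noteq> 0"
      using X_d by (auto simp: fun_eq_iff X_power_apply z_def)
    then have "size (A + z) = d" using supported_Ys[of bs0] bs0(1) unfolding supported_def by metis
    then show ?thesis using A by (simp add: z_def)
  qed
  \<comment> \<open>In \<open>Y_X0_power\<close> with \<open>k = d\<close> the left side vanishes.
    At the empty multiset this gives \<open>\<psi> c * Ys bs z + W c (Ys bs) z = 0\<close>, and
    \<open>W_Ys\<close> expands the second term.\<close>
  have reflect: "(\<Sum>i<d. Ys (bs[i := bs ! i + c]) z) = \<psi> c * Ys bs z" if "length bs = d" for bs c
  proof -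
    let ?u = "Ys bs"
    have "fscale (- of_nat (Suc d)) (W c ((X 0 ^^ d) ?u) + (X 0 ^^ d) (W c ?u)) {#}
      = fscale 2 (Y c ((X 0 ^^ Suc d) ?u)) {#}"
      using Y_X0_power[OF Y_kill[OF that], of c d] by simp
    also have "\<dots> = 0" unfolding X_kill[OF that] by simp
    finally have "\<psi> c * ?u z + W c ?u z = 0"
      by (simp add: X_power_apply z_def del: of_nat_Suc)
    then show ?thesis by (simp add: W_Ys sum_fun_apply that)
  qed

  obtain N c where c: "\<exists>j\<le>N. c j \<noteq> 0" "(\<Sum>j\<le>N. fscale (c j) (Y (int j) F0)) = 0"
  proof -
    have "range (\<lambda>j. Y (int j) F0) \<subseteq> fs.span B"
    proof clarify
      fix j show "Y (int j) F0 \<in> fs.span B" using B(2) rangeI[of Ys "[int j]"] by auto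
    qed
    then show ?thesis using finite_span_relation[OF B(1)] that by blast
  qed
  \<comment> \<open>\<open>Y b F0\<close> is supported on singletons and its value at
    \<open>{#a#}\<close> depends only on \<open>a + b\<close>, so the indices of the relation can be
    translated.\<close>
  have rel: "(\<Sum>j\<le>N. fscale (c j) (Y (e + int j) F0)) = 0" for e
  proof
    fix A
    show "(\<Sum>j\<le>N. fscale (c j) (Y (e + int j) F0)) A = 0 A"
    proof (cases "size A = 1")
      case True
      then obtain a where A: "A = {#a#}" using size_1_singleton_mset by blast
      have "(\<Sum>j\<le>N. fscale (c j) (Y (int j) F0)) {#a + e#} = 0" by (simp add: c(2))
      then show ?thesis by (simp add: A sum_fun_apply Y_F0_singleton add.assoc)
    next
      case False
      then have "Ys [b] A = 0" for b using supported_Ys[of "[b]"] unfolding supported_def by simp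
      then show ?thesis by (simp add: sum_fun_apply)
    qed
  qed
  define p where "p = (\<Sum>j\<le>N. monom (c j) j)"
  have coeff_p: "coeff p j = (if j \<le> N then c j else 0)" for j
    by (simp add: p_def coeff_sum)
  have p0: "p \<noteq> 0" using c(1) coeff_p by (metis coeff_0)

  define T where "T = (\<lambda>b. Ys (map b [0..<d]) z)"
  have T_sum: "(\<Sum>i<d. T (shift i e b)) = \<psi> e * T b" for b e
  proof -
    have "T (shift i e b) = Ys ((map b [0..<d])[i := map b [0..<d] ! i + e]) z" if "i < d" for i
    proof -
      have "map (shift i e b) [0..<d] = (map b [0..<d])[i := map b [0..<d] ! i + e]"
        using that by (intro nth_equalityI) (auto simp: shift_def nth_list_update)
      then show ?thesis by (simp add: T_def)
    qed
    then have "(\<Sum>i<d. T (shift i e b)) = (\<Sum>i<d. Ys ((map b [0..<d])[i := map b [0..<d] ! i + e]) z)"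
      by (intro sum.cong) auto
    also have "\<dots> = \<psi> e * T b" unfolding T_def by (rule reflect) simp
    finally show ?thesis .
  qed
  have T_poly: "(\<Sum>j\<le>degree p. coeff p j * T (shift i (int j) b)) = 0" if i: "i < d" for i b
  proof -
    let ?xs = "map b [0..<i]" and ?ys = "map b [Suc i..<d]"
    \<comment> \<open>The \<open>Y\<close> operators commute, so the factor for coordinate
      \<open>i\<close> can be moved next to \<open>F0\<close>, where \<open>rel\<close>
      applies.\<close>
    have T_shift: "T (shift i e b) = foldr Y ?xs (foldr Y ?ys (Y (b i + e) F0)) z" for e
    proof -
      have "[0..<d] = [0..<i] @ i # [Suc i..<d]"
        using i by (metis append_Cons append_Nil le_add1 less_imp_add_positive upt_add_eq_append upt_conv_Cons add_0 less_imp_le_nat)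
      then have "map (shift i e b) [0..<d] = ?xs @ (b i + e) # ?ys"
        by (simp add: shift_def)
      then show ?thesis by (simp add: T_def foldr_Y_commute)
    qed
    have "degree p \<le> N" by (rule degree_le) (simp add: coeff_p)
    then have "(\<Sum>j\<le>degree p. coeff p j * T (shift i (int j) b)) = (\<Sum>j\<le>N. c j * T (shift i (int j) b))"
      by (intro sum.mono_neutral_cong_left) (auto simp: coeff_p coeff_eq_0, metis coeff_p coeff_eq_0 not_le)
    also have "\<dots> = foldr Y ?xs (foldr Y ?ys (\<Sum>j\<le>N. fscale (c j) (Y (b i + int j) F0))) z"
      unfolding foldr_Y_sum foldr_Y_scale sum_fun_apply by (simp add: T_shift)
    also have "\<dots> = 0" by (simp add: rel)
    finally show ?thesis .
  qed
  have "map ((!) bs0) [0..<d] = bs0" using bs0(1) by (metis map_nth)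
  then have "T ((!) bs0) \<noteq> 0" using z_nonzero by (simp add: T_def)
  then obtain \<alpha> where \<alpha>: "\<And>i. i < d \<Longrightarrow> \<alpha> i \<noteq> 0" "\<And>e. \<psi> e = (\<Sum>i<d. \<alpha> i powi e)"
    using power_sums_of_shift_identity[OF _ T_sum p0 T_poly] by blast
  have "(\<Sum>i<d. \<alpha> i powi e) = (\<Sum>i=1..d. \<alpha> (i - 1) powi e)" for e
    by (rule sum.reindex_bij_witness[of _ "\<lambda>i. i - 1" Suc]) auto
  then show ?thesis
    using \<alpha> by (intro exI[of _ d] exI[of _ "\<lambda>i. \<alpha> (i - 1)"]) auto
qed

end

theorem theorem5p1p3:
  fixes \<phi> :: "ltw \<Rightarrow> complex"
  assumes "\<phi> \<in> ltw_zero_dual"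
  shows "rep_finite_dim (simple_hw_module \<phi>) \<longleftrightarrow>
    (\<exists>(n::nat) (\<alpha>::nat \<Rightarrow> complex). (\<forall>i\<in>{1..n}. \<alpha> i \<noteq> 0) \<and>
       (\<forall>a::int. \<phi> (w_elt a) = (\<Sum>i=1..n. \<alpha> i powi a)))"
proof -
  interpret hw_module \<phi> by unfold_locales (rule assms)
  show ?thesis
    unfolding finite_dim_iff range_eval_word
  proof
    assume "\<exists>B. finite B \<and> fs.span (range Ys) \<subseteq> fs.span B"
    then obtain B where "finite B" "range Ys \<subseteq> fs.span B"
      using fs.span_superset by blast
    then show "\<exists>(n::nat) \<alpha>. (\<forall>i\<in>{1..n}. \<alpha> i \<noteq> 0) \<and> (\<forall>a. \<phi> (w_elt a) = (\<Sum>i=1..n. \<alpha> i powi a))"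
      by (rule power_sums_of_finite_span)
  next
    assume "\<exists>(n::nat) \<alpha>. (\<forall>i\<in>{1..n}. \<alpha> i \<noteq> 0) \<and> (\<forall>a. \<phi> (w_elt a) = (\<Sum>i=1..n. \<alpha> i powi a))"
    then obtain n :: nat and \<alpha> where "\<forall>i\<in>{1..n}. \<alpha> i \<noteq> 0" "\<forall>a. \<phi> (w_elt a) = (\<Sum>i=1..n. \<alpha> i powi a)"
      by blast
    then interpret integral_weight \<psi> n \<alpha> by unfold_locales auto
    show "\<exists>B. finite B \<and> fs.span (range Ys) \<subseteq> fs.span B"
      by (rule Y_words_finite_span)
  qed
qed

end
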